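(* Let $\{x_k\}$ be an infinite sequence generated by the SQP-type algorithm described in the context, under Assumption A, with penalty parameters $\{\rho_k\}$, multipliers $\{(\hat\mu_{k+1},\hat Y_{k+1})\}$ and optimality residuals $R_k^{opt}:=R^{opt}(x_k,\rho_k,\hat\mu_{k+1},\hat Y_{k+1})$. If $\lim_{k\to\infty}\rho_k=\rho^*>0$ and $\lim_{k\to\infty}v_k=0$, then $$\lim_{k\to\infty}R_k^{opt}=0.$$ Thus, every limit point $(x^*,\hat\mu^*/\rho^*,\hat Y^*/\rho^* )$ of the sequence $\{(x_k,\hat\mu_{k+1}/\rho_k,\hat Y_{k+1}/\rho_k)\}$ is a KKT point for the problem: minimize $f(x)$ subject to $h(x)=0$, $G(x)\preceq0$.
   Context: Notation. $\mathcal S^m$ is the space of real symmetric $m\times m$ matrices, $\langle A,B\rangle=\mathrm{tr}(AB)$, $\preceq$ is the Loewner order, $\lambda_1(A)$ is the largest eigenvalue of $A$, $[a]_+=\max\{0,a\}$, $e_l=(1,\dots,1)^T\in\mathbb R^l$, $I_m$ is the identity. Data: $f:\mathbb R^n\to\mathbb R$, $h:\mathbb R^n\to\mathbb R^l$, $G:\mathbb R^n\to\mathcal S^m$; $g=\nabla f$; $Dh(x)$ is the Jacobian of $h$; $DG(x)d=\sum_i d_i\,\partial G(x)/\partial x_i$; $DG(x)^*Y=(\langle\partial G(x)/\partial x_1,Y\rangle,\dots,\langle\partial G(x)/\partial x_n,Y\rangle)^T$. Subscript $k$ means evaluation at $x_k$ ($f_k,g_k,h_k,G_k,v_k$). Original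 problem (P): minimize $f(x)$ subject to $h(x)=0$, $G(x)\preceq0$. A triple $(x,\mu,Y)$ is a KKT point of (P) if $g(x)+Dh(x)^T\mu+DG(x)^*Y=0$, $h(x)=0$, $G(x)\preceq0$, $\langle Y,G(x)\rangle=0$, $Y\succeq0$. Constraint violation: $v(x)=\|h(x)\|_1+[\lambda_1(G(x))]_+$. Penalty function: $P^\rho(x)=\rho f(x)+v(x)$. Linearizations at $x_k$: $l_k^v(d)=\|h_k+Dh(x_k)d\|_1+[\lambda_1(G_k+DG(x_k)d)]_+$, $\Delta l_k^v(d)=l_k^v(0)-l_k^v(d)$, $\Delta l_k^\rho(d)=-\rho g_k^Td+\Delta l_k^v(d)$. Fritz-John function: $F(x,\rho,\mu,Y)=\rho f(x)+\mu^Th(x)+\langle Y,G(x)\rangle$. Optimality residual: $R^{opt}(x,\rho,\mu,Y)=\|\nabla_xF(x,\rho,\mu,Y)\|_\infty+\|YG(x)\|_F$. Algorithm. Constants $\epsilon,\delta,\eta,\gamma\in(0,1)$, start $x_0\in\mathbb R^n$, $\rho_0>0$; positive definite matrices $B_k^{fea},B_k\in\mathcal S^n$ are given at each iteration. Iteration $k$: (1) Solve $\min_{d,r,s,t}\ e_l^T(r+s)+t+\frac12d^TB_k^{fea}d$ s.t. $h_k+Dh(x_k)d=r-s$, $G_k+DG(x_k)d\preceq tI_m$, $r\ge0,s\ge0,t\ge0$ ($r,s\in\mathbb R^l$, $t\in\mathbb R$), giving $(d_k^{fea},r_k,s_k,t_k)$ and Lagrange multipliers $(\bar\mu_{k+1},\bar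 Y_{k+1})\in\mathbb R^l\times\mathcal S^m$ for the equality and semidefinite constraints (Lagrangian: objective $+\mu^T(h_k+Dh(x_k)d-r+s)+\langle Y,G_k+DG(x_k)d-tI_m\rangle-\nu_r^Tr-\nu_s^Ts-\nu_tt$, with $Y\succeq0$ and $\nu_r,\nu_s,\nu_t\ge0$). (2) Solve $\min_d\ \rho_kg_k^Td+\frac12d^TB_kd$ s.t. $h_k+Dh(x_k)d=r_k-s_k$, $G_k+DG(x_k)d\preceq t_kI_m$, giving $d_k$ and Lagrange multipliers $(\hat\mu_{k+1},\hat Y_{k+1})$, which are taken to exist: $\rho_kg_k+B_kd_k+Dh(x_k)^T\hat\mu_{k+1}+DG(x_k)^*\hat Y_{k+1}=0$, $\hat Y_{k+1}\succeq0$, $\langle\hat Y_{k+1},G_k+DG(x_k)d_k-t_kI_m\rangle=0$. (3) If $d_k=0$, stop. (4) If $\rho_k(\|\bar\mu_{k+1}\|_\infty+\mathrm{tr}(\bar Y_{k+1}))>1$ or $\rho_k(\|\hat\mu_{k+1}\|_\infty+\mathrm{tr}(\hat Y_{k+1}))>1$, set $\rho_k'=\min\{\delta\rho_k,(1-\epsilon)/(\|\bar\mu_{k+1}\|_\infty+\mathrm{tr}(\bar Y_{k+1})+\|\hat\mu_{k+1}\|_\infty+\mathrm{tr}(\hat Y_{k+1}))\}$; otherwise $\rho_k'=\rho_k$. If $\Delta l_k^{\rho_k'}(d_k)<\epsilon\Delta l_k^v(d_k)$, set $\rho_{k+1}=\min\{\delta\rho_k',\zeta_k\}$ with $\zeta_k=(1-\epsilon)\Delta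 l_k^v(d_k)/(g_k^Td_k+\frac12d_k^TB_kd_k)$; otherwise $\rho_{k+1}=\rho_k'$. (5) Let $\alpha_k$ be the first $\alpha\in\{1,\gamma,\gamma^2,\dots\}$ with $P^{\rho_{k+1}}(x_k+\alpha d_k)-P^{\rho_{k+1}}(x_k)\le-\eta\alpha\Delta l_k^{\rho_{k+1}}(d_k)$; set $x_{k+1}=x_k+\alpha_kd_k$. (No cap on the number of iterations.) Assumption A. (A1) $f,h,G$ are twice continuously differentiable. (A2) There is a convex compact set $\Omega\subseteq\mathbb R^n$ with $x_k\in\Omega$ for all $k$. (A3) There are constants $0<b_1<b_2$ with $b_1\|d\|^2\le d^TB_k^{fea}d\le b_2\|d\|^2$ and $b_1\|d\|^2\le d^TB_kd\le b_2\|d\|^2$ for all $k$ and $d\in\mathbb R^n$. *)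

theory Defs
  imports "HOL-Analysis.Analysis"
begin

definition symmetric_matrix :: "real^'m^'m \<Rightarrow> bool" where
  "symmetric_matrix A \<longleftrightarrow> transpose A = A"

definition psd :: "real^'m^'m \<Rightarrow> bool" where
  "psd A \<longleftrightarrow> symmetric_matrix A \<and> (\<forall>u. 0 \<le> u \<bullet> (A *v u))"

definition pos_def :: "real^'m^'m \<Rightarrow> bool" where
  "pos_def A \<longleftrightarrow> symmetric_matrix A \<and> (\<forall>u. u \<noteq> 0 \<longrightarrow> 0 < u \<bullet> (A *v u))"

definition loewner_le :: "real^'m^'m \<Rightarrow> real^'m^'m \<Rightarrow> bool" (infix "\<preceq>\<^sub>L" 50) where
  "A \<preceq>\<^sub>L B \<longleftrightarrow> psd (B - A)"

definition trace_inner :: "real^'m^'m \<Rightarrow> real^'m^'m \<Rightarrow> real" where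
  "trace_inner A B = trace (A ** B)"

definition eigenvalue :: "real^'m^'m \<Rightarrow> real \<Rightarrow> bool" where
  "eigenvalue A c \<longleftrightarrow> (\<exists>u. u \<noteq> 0 \<and> A *v u = c *\<^sub>R u)"

text \<open>Used for symmetric matrices only, whose set of real eigenvalues is finite and nonempty.\<close>
definition lambda_max :: "real^'m^'m \<Rightarrow> real" where
  "lambda_max A = Max {c. eigenvalue A c}"

definition norm1 :: "real^'l \<Rightarrow> real" where
  "norm1 y = (\<Sum>i\<in>UNIV. \<bar>y $ i\<bar>)"

definition twice_continuously_differentiable ::
    "('a::real_normed_vector \<Rightarrow> 'b::real_normed_vector) \<Rightarrow> bool" where
  "twice_continuously_differentiable \<phi> \<longleftrightarrow>
     (\<exists>(\<phi>' :: 'a \<Rightarrow> 'a \<Rightarrow>\<^sub>L 'b) (\<phi>'' :: 'a \<Rightarrow> 'a \<Rightarrow>\<^sub>L ('a \<Rightarrow>\<^sub>L 'b)).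
        (\<forall>x. (\<phi> has_derivative blinfun_apply (\<phi>' x)) (at x)) \<and>
        (\<forall>x. (\<phi>' has_derivative blinfun_apply (\<phi>'' x)) (at x)) \<and>
        continuous_on UNIV \<phi>'')"

definition grad :: "(real^'n \<Rightarrow> real) \<Rightarrow> real^'n \<Rightarrow> real^'n" where
  "grad \<phi> x = (THE D. GDERIV \<phi> x :> D)"

definition partial_deriv :: "(real^'n \<Rightarrow> 'b::real_normed_vector) \<Rightarrow> real^'n \<Rightarrow> 'n \<Rightarrow> 'b" where
  "partial_deriv \<phi> x i = vector_derivative (\<lambda>\<tau>. \<phi> (x + \<tau> *\<^sub>R axis i 1)) (at 0)"

definition DG_apply :: "(real^'n \<Rightarrow> real^'m^'m) \<Rightarrow> real^'n \<Rightarrow> real^'n \<Rightarrow> real^'m^'m" where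
  "DG_apply G x d = (\<Sum>i\<in>UNIV. (d $ i) *\<^sub>R partial_deriv G x i)"

definition DG_adjoint :: "(real^'n \<Rightarrow> real^'m^'m) \<Rightarrow> real^'n \<Rightarrow> real^'m^'m \<Rightarrow> real^'n" where
  "DG_adjoint G x Y = (\<chi> i. trace_inner (partial_deriv G x i) Y)"

definition lin_h :: "(real^'n \<Rightarrow> real^'l) \<Rightarrow> real^'n \<Rightarrow> real^'n \<Rightarrow> real^'l" where
  "lin_h h x d = h x + jacobian h (at x) *v d"

definition lin_G :: "(real^'n \<Rightarrow> real^'m^'m) \<Rightarrow> real^'n \<Rightarrow> real^'n \<Rightarrow> real^'m^'m" where
  "lin_G G x d = G x + DG_apply G x d"

definition KKT_point ::
    "(real^'n \<Rightarrow> real) \<Rightarrow> (real^'n \<Rightarrow> real^'l) \<Rightarrow> (real^'n \<Rightarrow> real^'m^'m)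
      \<Rightarrow> real^'n \<Rightarrow> real^'l \<Rightarrow> real^'m^'m \<Rightarrow> bool" where
  "KKT_point f h G x \<mu> Y \<longleftrightarrow>
     grad f x + transpose (jacobian h (at x)) *v \<mu> + DG_adjoint G x Y = 0 \<and>
     h x = 0 \<and> G x \<preceq>\<^sub>L 0 \<and> trace_inner Y (G x) = 0 \<and> psd Y"

definition viol :: "(real^'n \<Rightarrow> real^'l) \<Rightarrow> (real^'n \<Rightarrow> real^'m^'m) \<Rightarrow> real^'n \<Rightarrow> real" where
  "viol h G x = norm1 (h x) + max 0 (lambda_max (G x))"

definition penalty ::
    "(real^'n \<Rightarrow> real) \<Rightarrow> (real^'n \<Rightarrow> real^'l) \<Rightarrow> (real^'n \<Rightarrow> real^'m^'m)
      \<Rightarrow> real \<Rightarrow> real^'n \<Rightarrow> real" where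
  "penalty f h G \<rho> x = \<rho> * f x + viol h G x"

definition lin_viol ::
    "(real^'n \<Rightarrow> real^'l) \<Rightarrow> (real^'n \<Rightarrow> real^'m^'m) \<Rightarrow> real^'n \<Rightarrow> real^'n \<Rightarrow> real" where
  "lin_viol h G x d = norm1 (lin_h h x d) + max 0 (lambda_max (lin_G G x d))"

definition red_viol ::
    "(real^'n \<Rightarrow> real^'l) \<Rightarrow> (real^'n \<Rightarrow> real^'m^'m) \<Rightarrow> real^'n \<Rightarrow> real^'n \<Rightarrow> real" where
  "red_viol h G x d = lin_viol h G x 0 - lin_viol h G x d"

definition red_penalty ::
    "(real^'n \<Rightarrow> real) \<Rightarrow> (real^'n \<Rightarrow> real^'l) \<Rightarrow> (real^'n \<Rightarrow> real^'m^'m)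
      \<Rightarrow> real \<Rightarrow> real^'n \<Rightarrow> real^'n \<Rightarrow> real" where
  "red_penalty f h G \<rho> x d = - \<rho> * (grad f x \<bullet> d) + red_viol h G x d"

definition fritz_john ::
    "(real^'n \<Rightarrow> real) \<Rightarrow> (real^'n \<Rightarrow> real^'l) \<Rightarrow> (real^'n \<Rightarrow> real^'m^'m)
      \<Rightarrow> real^'n \<Rightarrow> real \<Rightarrow> real^'l \<Rightarrow> real^'m^'m \<Rightarrow> real" where
  "fritz_john f h G x \<rho> \<mu> Y = \<rho> * f x + \<mu> \<bullet> h x + trace_inner Y (G x)"

text \<open>The library norm on \<^typ>\<open>real^'m^'m\<close> is the Frobenius norm.\<close>
definition R_opt ::
    "(real^'n \<Rightarrow> real) \<Rightarrow> (real^'n \<Rightarrow> real^'l) \<Rightarrow> (real^'n \<Rightarrow> real^'m^'m)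
      \<Rightarrow> real^'n \<Rightarrow> real \<Rightarrow> real^'l \<Rightarrow> real^'m^'m \<Rightarrow> real" where
  "R_opt f h G x \<rho> \<mu> Y =
     infnorm (grad (\<lambda>z. fritz_john f h G z \<rho> \<mu> Y) x) + norm (Y ** G x)"

text \<open>The constant \<open>1\<close> of type \<^typ>\<open>real^'l\<close> is the all-ones vector; \<open>0 \<le> r\<close> on vectors is
  componentwise; \<^term>\<open>mat t\<close> is \<open>t\<close> times the identity matrix.\<close>

definition fea_feasible ::
    "(real^'n \<Rightarrow> real^'l) \<Rightarrow> (real^'n \<Rightarrow> real^'m^'m) \<Rightarrow> real^'n
      \<Rightarrow> (real^'n) \<times> (real^'l) \<times> (real^'l) \<times> real \<Rightarrow> bool" where
  "fea_feasible h G x = (\<lambda>(d, r, s, t).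
     lin_h h x d = r - s \<and> lin_G G x d \<preceq>\<^sub>L mat t \<and> 0 \<le> r \<and> 0 \<le> s \<and> 0 \<le> t)"

definition fea_objective ::
    "real^'n^'n \<Rightarrow> (real^'n) \<times> (real^'l) \<times> (real^'l) \<times> real \<Rightarrow> real" where
  "fea_objective Bf = (\<lambda>(d, r, s, t). 1 \<bullet> (r + s) + t + (1/2) * (d \<bullet> (Bf *v d)))"

text \<open>The four equations are the vanishing of the derivatives with respect to
  \<open>d\<close>, \<open>r\<close>, \<open>s\<close>, \<open>t\<close> of the Lagrangian
  \<open>fea_objective Bf (d,r,s,t) + \<mu>\<^sup>T (lin_h h x d - r + s) + \<langle>Y, lin_G G x d - t I\<rangle>
    - \<nu>r\<^sup>T r - \<nu>s\<^sup>T s - \<nu>t t\<close>.\<close>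
definition fea_multipliers ::
    "(real^'n \<Rightarrow> real^'l) \<Rightarrow> (real^'n \<Rightarrow> real^'m^'m) \<Rightarrow> real^'n^'n \<Rightarrow> real^'n
      \<Rightarrow> (real^'n) \<times> (real^'l) \<times> (real^'l) \<times> real \<Rightarrow> real^'l \<Rightarrow> real^'m^'m \<Rightarrow> bool" where
  "fea_multipliers h G Bf x = (\<lambda>(d, r, s, t) \<mu> Y. \<exists>(\<nu>r :: real^'l) (\<nu>s :: real^'l) (\<nu>t :: real).
     Bf *v d + transpose (jacobian h (at x)) *v \<mu> + DG_adjoint G x Y = 0 \<and>
     1 - \<mu> - \<nu>r = 0 \<and> 1 + \<mu> - \<nu>s = 0 \<and> 1 - trace Y - \<nu>t = 0 \<and>
     psd Y \<and> 0 \<le> \<nu>r \<and> 0 \<le> \<nu>s \<and> 0 \<le> \<nu>t \<and>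
     trace_inner Y (lin_G G x d - mat t) = 0 \<and> \<nu>r \<bullet> r = 0 \<and> \<nu>s \<bullet> s = 0 \<and> \<nu>t * t = 0)"

definition opt_feasible ::
    "(real^'n \<Rightarrow> real^'l) \<Rightarrow> (real^'n \<Rightarrow> real^'m^'m) \<Rightarrow> real^'n
      \<Rightarrow> real^'l \<Rightarrow> real^'l \<Rightarrow> real \<Rightarrow> real^'n \<Rightarrow> bool" where
  "opt_feasible h G x r s t d \<longleftrightarrow> lin_h h x d = r - s \<and> lin_G G x d \<preceq>\<^sub>L mat t"

definition opt_objective ::
    "(real^'n \<Rightarrow> real) \<Rightarrow> real^'n^'n \<Rightarrow> real \<Rightarrow> real^'n \<Rightarrow> real^'n \<Rightarrow> real" where
  "opt_objective f B \<rho> x d = \<rho> * (grad f x \<bullet> d) + (1/2) * (d \<bullet> (B *v d))"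

definition opt_multipliers ::
    "(real^'n \<Rightarrow> real) \<Rightarrow> (real^'n \<Rightarrow> real^'l) \<Rightarrow> (real^'n \<Rightarrow> real^'m^'m) \<Rightarrow> real^'n^'n
      \<Rightarrow> real \<Rightarrow> real^'n \<Rightarrow> real \<Rightarrow> real^'n \<Rightarrow> real^'l \<Rightarrow> real^'m^'m \<Rightarrow> bool" where
  "opt_multipliers f h G B \<rho> x t d \<mu> Y \<longleftrightarrow>
     \<rho> *\<^sub>R grad f x + B *v d + transpose (jacobian h (at x)) *v \<mu> + DG_adjoint G x Y = 0 \<and>
     psd Y \<and> trace_inner Y (lin_G G x d - mat t) = 0"

definition armijo ::
    "(real^'n \<Rightarrow> real) \<Rightarrow> (real^'n \<Rightarrow> real^'l) \<Rightarrow> (real^'n \<Rightarrow> real^'m^'m)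
      \<Rightarrow> real \<Rightarrow> real \<Rightarrow> real^'n \<Rightarrow> real^'n \<Rightarrow> real \<Rightarrow> bool" where
  "armijo f h G \<eta> \<rho> x d a \<longleftrightarrow>
     penalty f h G \<rho> (x + a *\<^sub>R d) - penalty f h G \<rho> x \<le> - \<eta> * a * red_penalty f h G \<rho> x d"

text \<open>A run that never stops, hence \<open>d k \<noteq> 0\<close> for all \<open>k\<close>. The multipliers computed in
  iteration \<open>k\<close> carry the index \<open>Suc k\<close>; their values at index \<open>0\<close> are irrelevant. The sequence
  \<open>\<rho>'\<close> holds the penalty parameters after the first of the two updates of each iteration.\<close>
locale sqp_run =
  fixes f :: "real^'n \<Rightarrow> real"
    and h :: "real^'n \<Rightarrow> real^'l"
    and G :: "real^'n \<Rightarrow> real^'m^'m"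
    and \<epsilon> \<delta> \<eta> \<gamma> :: real
    and Bfea B :: "nat \<Rightarrow> real^'n^'n"
    and x dfea d :: "nat \<Rightarrow> real^'n"
    and r s :: "nat \<Rightarrow> real^'l"
    and t :: "nat \<Rightarrow> real"
    and \<mu>bar \<mu>hat :: "nat \<Rightarrow> real^'l"
    and Ybar Yhat :: "nat \<Rightarrow> real^'m^'m"
    and \<rho> \<rho>' \<alpha> :: "nat \<Rightarrow> real"
  assumes G_symmetric: "\<And>z. symmetric_matrix (G z)"
    and constants: "\<epsilon> \<in> {0<..<1}" "\<delta> \<in> {0<..<1}" "\<eta> \<in> {0<..<1}" "\<gamma> \<in> {0<..<1}"
    and rho0: "\<rho> 0 > 0"
    and B_pos_def: "\<And>k. pos_def (Bfea k)" "\<And>k. pos_def (B k)"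
    and fea_solution:
      "\<And>k. is_arg_min (fea_objective (Bfea k)) (fea_feasible h G (x k)) (dfea k, r k, s k, t k)"
    and fea_mult:
      "\<And>k. fea_multipliers h G (Bfea k) (x k) (dfea k, r k, s k, t k) (\<mu>bar (Suc k)) (Ybar (Suc k))"
    and opt_solution:
      "\<And>k. is_arg_min (opt_objective f (B k) (\<rho> k) (x k))
             (opt_feasible h G (x k) (r k) (s k) (t k)) (d k)"
    and opt_mult:
      "\<And>k. opt_multipliers f h G (B k) (\<rho> k) (x k) (t k) (d k) (\<mu>hat (Suc k)) (Yhat (Suc k))"
    and no_stop: "\<And>k. d k \<noteq> 0"
    and rho'_update:
      "\<And>k. \<rho>' k =
         (if \<rho> k * (infnorm (\<mu>bar (Suc k)) + trace (Ybar (Suc k))) > 1 \<or>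
             \<rho> k * (infnorm (\<mu>hat (Suc k)) + trace (Yhat (Suc k))) > 1
          then min (\<delta> * \<rho> k)
                 ((1 - \<epsilon>) / (infnorm (\<mu>bar (Suc k)) + trace (Ybar (Suc k))
                              + infnorm (\<mu>hat (Suc k)) + trace (Yhat (Suc k))))
          else \<rho> k)"
    and rho_update:
      "\<And>k. \<rho> (Suc k) =
         (if red_penalty f h G (\<rho>' k) (x k) (d k) < \<epsilon> * red_viol h G (x k) (d k)
          then min (\<delta> * \<rho>' k)
                 ((1 - \<epsilon>) * red_viol h G (x k) (d k)
                    / (grad f (x k) \<bullet> d k + (1/2) * (d k \<bullet> (B k *v d k))))
          else \<rho>' k)"
    and line_search:
      "\<And>k. \<exists>j. \<alpha> k = \<gamma> ^ j \<and> armijo f h G \<eta> (\<rho> (Suc k)) (x k) (d k) (\<gamma> ^ j) \<and>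
               (\<forall>i<j. \<not> armijo f h G \<eta> (\<rho> (Suc k)) (x k) (d k) (\<gamma> ^ i))"
    and step: "\<And>k. x (Suc k) = x k + \<alpha> k *\<^sub>R d k"

definition assumption_A ::
    "(real^'n \<Rightarrow> real) \<Rightarrow> (real^'n \<Rightarrow> real^'l) \<Rightarrow> (real^'n \<Rightarrow> real^'m^'m)
      \<Rightarrow> (nat \<Rightarrow> real^'n^'n) \<Rightarrow> (nat \<Rightarrow> real^'n^'n) \<Rightarrow> (nat \<Rightarrow> real^'n) \<Rightarrow> bool" where
  "assumption_A f h G Bfea B x \<longleftrightarrow>
     twice_continuously_differentiable f \<and>
     twice_continuously_differentiable h \<and>
     twice_continuously_differentiable G \<and>
     (\<exists>\<Omega>. convex \<Omega> \<and> compact \<Omega> \<and> (\<forall>k. x k \<in> \<Omega>)) \<and>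
     (\<exists>b1 b2. 0 < b1 \<and> b1 < b2 \<and>
        (\<forall>k d. b1 * (norm d)\<^sup>2 \<le> d \<bullet> (Bfea k *v d) \<and> d \<bullet> (Bfea k *v d) \<le> b2 * (norm d)\<^sup>2 \<and>
               b1 * (norm d)\<^sup>2 \<le> d \<bullet> (B k *v d) \<and> d \<bullet> (B k *v d) \<le> b2 * (norm d)\<^sup>2))"

end

theory Submission
  imports Defs
begin

text \<open>Two facts about the computed multipliers turn the residual into something that the iterates
control. Stationarity says that the gradient of the Fritz-John function equals \<open>- B\<^sub>k d\<^sub>k\<close>
(lemma \<open>lagrangian_gradient\<close>). Complementarity of two positive semidefinite matrices with vanishing
inner product is complementarity of their matrix product, so that
\<open>Y\<^sub>k G\<^sub>k = t\<^sub>k Y\<^sub>k - Y\<^sub>k DG\<^sub>k d\<^sub>k\<close> (lemma \<open>complementarity\<close>). Since \<open>0 \<le> t\<^sub>k \<le> v\<^sub>k\<close> and \<open>v\<^sub>k\<close> tends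
to \<open>0\<close>, everything follows once the multipliers stay bounded and \<open>d\<^sub>k\<close> tends to \<open>0\<close>.

Boundedness comes from the penalty parameter. Every genuine update multiplies it by at most
\<open>\<delta> < 1\<close>, hence a positive limit forces it to be constant from some iteration on
(lemma \<open>rho_eventually_limit\<close>). From then on none of the tests that trigger an update succeeds, which bounds
\<open>\<parallel>\<mu>\<^sub>k\<parallel>\<^sub>\<infinity> + tr Y\<^sub>k\<close> by \<open>1 / \<rho>\<^sup>*\<close> and makes the predicted decrease \<open>\<Delta>\<^sub>k\<close> of the penalty function nonnegative.

To see that \<open>d\<^sub>k\<close> tends to \<open>0\<close>, take the inner product of the stationarity condition with \<open>d\<^sub>k\<close>. It gives
\<open>b\<^sub>1 \<parallel>d\<^sub>k\<parallel>\<^sup>2 \<le> - \<rho>\<^sub>k g\<^sub>k\<^sup>T d\<^sub>k + O(v\<^sub>k) \<le> \<Delta>\<^sub>k + O(v\<^sub>k)\<close> (lemma \<open>curvature_bound\<close>). The first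
inequality bounds the steps; the second one reduces the claim to \<open>\<Delta>\<^sub>k \<longlonglongrightarrow> 0\<close>. With a fixed penalty
parameter the penalty function decreases along the iterates and is bounded below, so the line search yields
\<open>\<alpha>\<^sub>k \<Delta>\<^sub>k \<longlonglongrightarrow> 0\<close>. On bounded sets the penalty function differs from its
model by a quadratic term (lemma \<open>penalty_decrease\<close>), so a step length can only be rejected if it
exceeds a multiple of \<open>\<Delta>\<^sub>k\<close>. Thus \<open>\<alpha>\<^sub>k \<ge> min 1 (c \<Delta>\<^sub>k)\<close>, and \<open>\<Delta>\<^sub>k\<close> itself tends to \<open>0\<close>.

The KKT conditions at a limit point follow by dividing stationarity and complementarity by \<open>\<rho>\<^sub>k\<close> and
passing to the limit, because all problem data and first derivatives are continuous.\<close>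

section \<open>Symmetric matrices and their largest eigenvalue\<close>

lemma symmetric_matrix_inner_commute:
  assumes "symmetric_matrix A"
  shows "u \<bullet> (A *v w) = w \<bullet> (A *v u)"
  by (metis assms dot_lmul_matrix inner_commute symmetric_matrix_def vector_transpose_matrix)

text \<open>A quadratic polynomial \<open>\<tau> \<mapsto> (u + \<tau> w) \<bullet> A (u + \<tau> w)\<close> without negative values has nonpositive discriminant. Allowing
a subspace lets the same inequality serve for eigenvectors on invariant subspaces.\<close>
lemma nonneg_form_Cauchy_Schwarz:
  fixes A :: "real^'m^'m"
  assumes sym: "symmetric_matrix A" and S: "subspace S"
    and nonneg: "\<And>u. u \<in> S \<Longrightarrow> 0 \<le> u \<bullet> (A *v u)"
    and u: "u \<in> S" and w: "w \<in> S"
  shows "(u \<bullet> (A *v w))\<^sup>2 \<le> (u \<bullet> (A *v u)) * (w \<bullet> (A *v w))"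
proof -
  define a b c where "a = u \<bullet> (A *v u)" and "b = u \<bullet> (A *v w)" and "c = w \<bullet> (A *v w)"
  have quad: "0 \<le> a + 2 * \<tau> * b + \<tau>\<^sup>2 * c" for \<tau>
  proof -
    have "u + \<tau> *\<^sub>R w \<in> S"
      using S u w by (simp add: subspace_add subspace_scale)
    from nonneg[OF this] show ?thesis
      using symmetric_matrix_inner_commute[OF sym, of u w]
      by (simp add: a_def b_def c_def algebra_simps inner_left_distrib inner_right_distrib
          matrix_vector_right_distrib matrix_vector_mult_scaleR power2_eq_square)
  qed
  show ?thesis
  proof (cases "c = 0")
    case True
    have "b = 0"
    proof (rule ccontr)
      assume "b \<noteq> 0"
      \<comment> \<open>at this point the affine polynomial takes the value \<open>-1\<close>\<close>
      with quad[of "- (a + 1) / (2 * b)"] True show False by (simp add: field_simps)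
    qed
    then show ?thesis using True by (simp add: a_def b_def c_def)
  next
    case False
    then have "c > 0" using nonneg[OF w] by (simp add: c_def)
    \<comment> \<open>the minimizer of the polynomial\<close>
    with quad[of "- b / c"] have "b\<^sup>2 \<le> a * c"
      by (simp add: power2_eq_square field_simps)
    then show ?thesis by (simp add: a_def b_def c_def)
  qed
qed

lemma psd_vanishing_form:
  assumes "psd N" "u \<bullet> (N *v u) = 0"
  shows "N *v u = 0"
proof -
  have "((N *v u) \<bullet> (N *v u))\<^sup>2 \<le> 0"
    using nonneg_form_Cauchy_Schwarz[of N UNIV "N *v u" u] assms by (simp add: psd_def)
  then show ?thesis by simp
qed

lemma mat_times_vector: "mat c *v u = c *\<^sub>R (u :: real^'m)"
  by (simp add: mat_def matrix_vector_mult_def vec_eq_iff if_distrib[of "\<lambda>z. z * _"]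
      sum.delta cong: if_cong)

lemma symmetric_matrix_algebra:
  "symmetric_matrix (mat c :: real^'m^'m)"
  "symmetric_matrix A \<Longrightarrow> symmetric_matrix B \<Longrightarrow> symmetric_matrix (A - B)"
  "symmetric_matrix A \<Longrightarrow> symmetric_matrix B \<Longrightarrow> symmetric_matrix (A + B)"
  "symmetric_matrix A \<Longrightarrow> symmetric_matrix (c *\<^sub>R A)"
  by (auto simp: symmetric_matrix_def transpose_def vec_eq_iff mat_def)

text \<open>A maximizer \<open>e\<close> of the quadratic form on the unit sphere of \<open>S\<close> is an eigenvector: the form of
\<open>c I - A\<close> is nonnegative on \<open>S\<close> and vanishes at \<open>e\<close>, so by Cauchy--Schwarz \<open>(c I - A) e\<close> is
orthogonal to all of \<open>S\<close>, in particular to itself.\<close>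
lemma symmetric_matrix_top_eigenvector:
  fixes A :: "real^'m^'m"
  assumes sym: "symmetric_matrix A" and S: "subspace S" "S \<noteq> {0}"
    and inv: "\<And>u. u \<in> S \<Longrightarrow> A *v u \<in> S"
  obtains e c where "e \<in> S" "norm e = 1" "A *v e = c *\<^sub>R e"
    "\<And>u. u \<in> S \<Longrightarrow> u \<bullet> (A *v u) \<le> c * (norm u)\<^sup>2"
proof -
  obtain u0 where u0: "u0 \<in> S" "u0 \<noteq> 0"
    using S subspace_0 by blast
  have comp: "compact (S \<inter> sphere 0 1)"
    using closed_subspace[OF S(1)] by (simp add: closed_Int_compact)
  have ne: "S \<inter> sphere 0 1 \<noteq> {}"
  proof -
    have "u0 /\<^sub>R norm u0 \<in> S \<inter> sphere 0 1"
      using u0 S(1) by (simp add: subspace_scale)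
    then show ?thesis by blast
  qed
  have "continuous_on (S \<inter> sphere 0 1) (\<lambda>u. u \<bullet> (A *v u))"
    by (intro continuous_intros linear_continuous_on matrix_vector_mul_bounded_linear)
  from continuous_attains_sup[OF comp ne this] obtain e where
    e: "e \<in> S" "norm e = 1" and
    emax: "\<And>u. u \<in> S \<Longrightarrow> norm u = 1 \<Longrightarrow> u \<bullet> (A *v u) \<le> e \<bullet> (A *v e)"
    by auto
  define c where "c = e \<bullet> (A *v e)"
  have bound: "u \<bullet> (A *v u) \<le> c * (norm u)\<^sup>2" if u: "u \<in> S" for u
  proof (cases "u = 0")
    case False
    have "(u /\<^sub>R norm u) \<bullet> (A *v (u /\<^sub>R norm u)) \<le> c"
      unfolding c_def using u False S(1) by (intro emax) (simp_all add: subspace_scale)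
    then show ?thesis using False
      by (simp add: matrix_vector_mult_scaleR field_simps power2_eq_square)
  qed simp
  have C: "(mat c - A) *v u = c *\<^sub>R u - A *v u" for u
    by (simp add: matrix_vector_mult_diff_rdistrib mat_times_vector)
  define w where "w = c *\<^sub>R e - A *v e"
  have w: "w \<in> S" unfolding w_def using S(1) e inv by (simp add: subspace_diff subspace_scale)
  have "(w \<bullet> ((mat c - A) *v e))\<^sup>2 \<le> (w \<bullet> ((mat c - A) *v w)) * (e \<bullet> ((mat c - A) *v e))"
    using S(1) w e sym bound
    by (intro nonneg_form_Cauchy_Schwarz[where S = S])
      (auto simp: symmetric_matrix_algebra C inner_diff_right power2_norm_eq_inner)
  also have "e \<bullet> ((mat c - A) *v e) = 0"
    unfolding C using e by (simp add: inner_diff_right c_def norm_eq_1)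
  finally have "w = 0" by (simp add: C w_def)
  then have "A *v e = c *\<^sub>R e" by (simp add: w_def)
  with e(1,2) show ?thesis using bound by (rule that)
qed

lemma eigenvectors_orthogonal:
  assumes "symmetric_matrix A" "A *v u = a *\<^sub>R u" "A *v w = b *\<^sub>R w" "a \<noteq> b"
  shows "orthogonal u w"
  using symmetric_matrix_inner_commute[OF assms(1), of u w] assms(2-)
  by (auto simp: orthogonal_def inner_commute)

text \<open>An orthonormal set of eigenvectors of maximal cardinality spans the space. Otherwise its orthogonal
complement is a nonzero invariant subspace and contains one more eigenvector.\<close>
lemma spectral_decomposition:
  fixes A :: "real^'m^'m"
  assumes sym: "symmetric_matrix A"
  obtains E where "pairwise orthogonal E" "span E = UNIV"
    "\<forall>e\<in>E. norm e = 1 \<and> (\<exists>c. A *v e = c *\<^sub>R e)"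
proof -
  define P where "P E \<longleftrightarrow> pairwise orthogonal E \<and> (\<forall>e\<in>E. norm e = 1 \<and> (\<exists>c. A *v e = c *\<^sub>R e))" for E
  have bd: "finite E \<and> card E \<le> CARD('m)" if "P E" for E
  proof -
    have "independent E"
      using that by (intro pairwise_orthogonal_independent) (auto simp: P_def)
    then show ?thesis
      using independent_bound_general[of E] dim_subset_UNIV[of E] by (auto intro: order_trans)
  qed
  have "\<forall>E. P E \<longrightarrow> card E \<le> CARD('m)" using bd by blast
  moreover have "P {}" by (simp add: P_def)
  ultimately obtain E where E: "P E" and Emax: "\<And>E'. P E' \<Longrightarrow> card E' \<le> card E"
    using ex_has_greatest_nat[of P "{}" card "Suc (CARD('m))"] by (metis less_Suc_eq_le)
  define S where "S = {u. \<forall>e\<in>E. orthogonal e u}"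
  have S: "subspace S"
    unfolding S_def subspace_def
    by (auto simp: orthogonal_def inner_right_distrib)
  have inv: "A *v u \<in> S" if "u \<in> S" for u
  proof -
    have "e \<bullet> (A *v u) = 0" if "e \<in> E" for e
    proof -
      obtain c where "A *v e = c *\<^sub>R e" using E \<open>e \<in> E\<close> by (auto simp: P_def)
      then show ?thesis
        using symmetric_matrix_inner_commute[OF sym, of e u] \<open>u \<in> S\<close> \<open>e \<in> E\<close>
        by (auto simp: S_def orthogonal_def inner_commute)
    qed
    then show ?thesis by (simp add: S_def orthogonal_def)
  qed
  have "span E = UNIV"
  proof (rule ccontr)
    assume "span E \<noteq> UNIV"
    then have "dim E < DIM(real^'m)"
      using dim_eq_full[of E] dim_subset_UNIV[of E] by linarith
    from orthogonal_to_subspace_exists[OF this]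
    obtain z where "z \<noteq> 0" "\<And>y. y \<in> span E \<Longrightarrow> orthogonal z y" by blast
    then have "z \<in> S" by (auto simp: S_def span_base orthogonal_commute)
    with \<open>z \<noteq> 0\<close> have "S \<noteq> {0}" by auto
    obtain e c where e: "e \<in> S" "norm e = 1" "A *v e = c *\<^sub>R e"
      by (rule symmetric_matrix_top_eigenvector[OF sym S \<open>S \<noteq> {0}\<close> inv])
    have "e \<notin> E" using e by (auto simp: S_def orthogonal_def norm_eq_1)
    moreover have "P (insert e E)"
      using E e by (auto simp: P_def S_def pairwise_insert orthogonal_commute)
    then have "card (insert e E) \<le> card E" by (rule Emax)
    ultimately show False using bd[OF E] by simp
  qed
  with E show ?thesis by (intro that[of E]) (auto simp: P_def)
qed

text \<open>The maximum in the definition of \<open>lambda_max\<close> is meaningful because eigenvectors for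
different eigenvalues are orthogonal, hence independent, so there are finitely many eigenvalues;
the largest one is the maximum of the quadratic form on the unit sphere.\<close>
lemma lambda_max_properties:
  fixes A :: "real^'m^'m"
  assumes sym: "symmetric_matrix A"
  shows "u \<bullet> (A *v u) \<le> lambda_max A * (norm u)\<^sup>2"
    and "eigenvalue A (lambda_max A)"
proof -
  have "(UNIV :: (real^'m) set) \<noteq> {0}"
    by (metis UNIV_I singletonD zero_neq_one)
  from symmetric_matrix_top_eigenvector[OF sym subspace_UNIV this] obtain e c where
    e: "norm e = 1" "A *v e = c *\<^sub>R e"
    and bound: "\<And>u. u \<bullet> (A *v u) \<le> c * (norm u)\<^sup>2" by (metis UNIV_I)
  have "eigenvalue A c" using e by (auto simp: eigenvalue_def intro!: exI[of _ e])
  obtain vec where vec: "\<And>a. eigenvalue A a \<Longrightarrow> vec a \<noteq> 0 \<and> A *v vec a = a *\<^sub>R vec a"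
    unfolding eigenvalue_def by (rule that[of "\<lambda>a. SOME u. u \<noteq> 0 \<and> A *v u = a *\<^sub>R u"]) (rule someI_ex, simp add: eigenvalue_def)
  let ?L = "{a. eigenvalue A a}"
  have inj: "inj_on vec ?L"
    by (rule inj_onI) (metis mem_Collect_eq scaleR_right_imp_eq vec)
  have "pairwise orthogonal (vec ` ?L)"
    using vec eigenvectors_orthogonal[OF sym] by (auto simp: pairwise_def) metis
  then have "independent (vec ` ?L)"
    using vec by (intro pairwise_orthogonal_independent) auto
  then have fin: "finite ?L"
    using independent_bound_general finite_imageD inj by blast
  have "a \<le> c" if "eigenvalue A a" for a
    using bound[of "vec a"] vec[OF that] by (simp add: power2_norm_eq_inner)
  then have "lambda_max A = c"
    unfolding lambda_max_def using fin \<open>eigenvalue A c\<close> by (intro Max_eqI) auto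
  then show "u \<bullet> (A *v u) \<le> lambda_max A * (norm u)\<^sup>2" "eigenvalue A (lambda_max A)"
    using bound \<open>eigenvalue A c\<close> by auto
qed

lemma lambda_max_le_iff:
  assumes "symmetric_matrix A"
  shows "lambda_max A \<le> c \<longleftrightarrow> (\<forall>u. u \<bullet> (A *v u) \<le> c * (norm u)\<^sup>2)"
proof
  assume "lambda_max A \<le> c"
  then show "\<forall>u. u \<bullet> (A *v u) \<le> c * (norm u)\<^sup>2"
    using lambda_max_properties(1)[OF assms] by (meson mult_right_mono order_trans zero_le_power2)
next
  assume *: "\<forall>u. u \<bullet> (A *v u) \<le> c * (norm u)\<^sup>2"
  obtain e where "e \<noteq> 0" "A *v e = lambda_max A *\<^sub>R e"
    using lambda_max_properties(2)[OF assms] by (auto simp: eigenvalue_def)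
  with *[rule_format, of e] show "lambda_max A \<le> c"
    by (simp add: power2_norm_eq_inner)
qed

lemma loewner_le_mat_iff:
  assumes "symmetric_matrix A"
  shows "A \<preceq>\<^sub>L mat c \<longleftrightarrow> lambda_max A \<le> c"
  by (simp add: assms lambda_max_le_iff loewner_le_def psd_def symmetric_matrix_algebra
      matrix_vector_mult_diff_rdistrib mat_times_vector inner_diff_right power2_norm_eq_inner)

lemma norm_matrix_vector_le: "norm ((A :: real^'m^'n) *v u) \<le> norm A * norm u"
proof -
  have "norm (A *v u) = norm (\<chi> i. (A $ i) \<bullet> u)"
    by (rule arg_cong[where f = norm]) (simp add: vec_eq_iff matrix_vector_mult_def inner_vec_def)
  also have "\<dots> \<le> norm (\<chi> i. norm (A $ i) * norm u)"
    by (rule norm_le_componentwise_cart) (simp add: Cauchy_Schwarz_ineq2)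
  also have "\<dots> = norm A * norm u"
    by (simp add: norm_vec_def[of A] norm_vec_def[of "\<chi> i. norm (A $ i) * norm u"]
        L2_set_left_distrib)
  finally show ?thesis .
qed

lemma lambda_max_add_le:
  assumes "symmetric_matrix A" "symmetric_matrix B"
  shows "lambda_max (A + B) \<le> lambda_max A + lambda_max B"
  using lambda_max_properties(1)[OF assms(1)] lambda_max_properties(1)[OF assms(2)] assms
  by (subst lambda_max_le_iff)
    (auto simp: symmetric_matrix_algebra matrix_vector_mult_add_rdistrib inner_right_distrib
      distrib_right intro: add_mono)

lemma lambda_max_le_norm:
  assumes "symmetric_matrix A"
  shows "lambda_max A \<le> norm A"
  unfolding lambda_max_le_iff[OF assms]
proof
  fix u
  have "u \<bullet> (A *v u) \<le> norm u * norm (A *v u)" by (rule norm_cauchy_schwarz)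
  also have "\<dots> \<le> norm u * (norm A * norm u)"
    by (intro mult_left_mono norm_matrix_vector_le) simp
  finally show "u \<bullet> (A *v u) \<le> norm A * (norm u)\<^sup>2" by (simp add: power2_eq_square ac_simps)
qed

lemma lambda_max_scaleR:
  assumes "symmetric_matrix A" "0 \<le> c"
  shows "lambda_max (c *\<^sub>R A) \<le> c * lambda_max A"
  using lambda_max_properties(1)[OF assms(1)] assms
  by (subst lambda_max_le_iff)
    (simp_all add: symmetric_matrix_algebra mult.assoc mult_left_mono
      flip: scaleR_matrix_vector_assoc)

section \<open>Inner products of positive semidefinite matrices\<close>

text \<open>The inner product of the matrix type sums the products of corresponding entries. It is the trace of the
product as soon as one factor is symmetric, and it is more convenient: bilinearity and
continuity come for free.\<close>
lemma trace_inner_eq_inner: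
  assumes "symmetric_matrix B"
  shows "trace_inner A B = A \<bullet> B" "trace_inner B A = B \<bullet> A"
proof -
  have B: "B $ i $ j = B $ j $ i" for i j
    using assms by (simp add: symmetric_matrix_def transpose_def vec_eq_iff)
  show "trace_inner A B = A \<bullet> B"
    unfolding trace_inner_def trace_def matrix_matrix_mult_def inner_vec_def
    by (auto intro!: sum.cong simp: B[of i j for i j])
  then show "trace_inner B A = B \<bullet> A"
    by (metis inner_commute trace_inner_def trace_mul_sym)
qed

definition outer_product :: "real^'m \<Rightarrow> real^'m^'m" where
  "outer_product e = (\<chi> i j. e $ i * e $ j)"

lemma outer_product_times_vector: "outer_product e *v u = (e \<bullet> u) *\<^sub>R e"
  by (simp add: outer_product_def vec_eq_iff matrix_vector_mult_def inner_vec_def sum_distrib_left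
      ac_simps)

lemma inner_outer_product: "outer_product e \<bullet> A = e \<bullet> (A *v e)"
  by (simp add: outer_product_def matrix_vector_mult_def inner_vec_def sum_distrib_left ac_simps)

lemma norm_outer_product: "norm (outer_product e) = (norm e)\<^sup>2"
proof -
  have "outer_product e \<bullet> outer_product e = ((norm e)\<^sup>2)\<^sup>2"
    by (simp add: inner_outer_product outer_product_times_vector power2_norm_eq_inner
        power2_eq_square[of "(norm e)\<^sup>2"] del: inner_eq_zero_iff)
       (simp add: power2_eq_square)
  then have "(norm (outer_product e))\<^sup>2 = ((norm e)\<^sup>2)\<^sup>2"
    by (simp add: power2_norm_eq_inner)
  then show ?thesis by (rule power2_eq_imp_eq) simp_all
qed

lemma sum_matrix_times_vector:
  "(\<Sum>e\<in>E. M e) *v u = (\<Sum>e\<in>E. M e *v (u :: real^'m))"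
  by (induction E rule: infinite_finite_induct) (simp_all add: matrix_vector_mult_add_rdistrib)

lemma psd_sum_outer_products:
  fixes Y :: "real^'m^'m"
  assumes "psd Y"
  obtains E c where "finite E" "\<And>e. e \<in> E \<Longrightarrow> norm e = 1" "\<And>e. e \<in> E \<Longrightarrow> 0 \<le> c e"
    "Y = (\<Sum>e\<in>E. c e *\<^sub>R outer_product e)"
proof -
  from assms have "symmetric_matrix Y" by (simp add: psd_def)
  then obtain E where
    E: "pairwise orthogonal E" "span E = UNIV"
       "\<forall>e\<in>E. norm e = 1 \<and> (\<exists>c. Y *v e = c *\<^sub>R e)"
    by (rule spectral_decomposition)
  from E(3) obtain c where c: "\<And>e. e \<in> E \<Longrightarrow> Y *v e = c e *\<^sub>R e" by metis
  from E(3) have unit: "\<And>e. e \<in> E \<Longrightarrow> norm e = 1" by blast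
  have "independent E" using E by (intro pairwise_orthogonal_independent) (auto dest: unit)
  then have fin: "finite E" using independent_bound_general by blast
  have nn: "0 \<le> c e" if "e \<in> E" for e
  proof -
    have "0 \<le> e \<bullet> (Y *v e)" using assms by (simp add: psd_def)
    then show ?thesis using unit[OF that] c[OF that] by (simp add: norm_eq_1)
  qed
  have "Y *v u = (\<Sum>e\<in>E. c e *\<^sub>R outer_product e) *v u" for u
  proof -
    have "u \<in> span E" using E by simp
    then show ?thesis
    proof (rule linear_eq_on[rotated 2])
      fix b assume b: "b \<in> E"
      have "(\<Sum>e\<in>E. c e *\<^sub>R outer_product e) *v b = (\<Sum>e\<in>E. (c e * (e \<bullet> b)) *\<^sub>R e)"
        by (simp add: sum_matrix_times_vector outer_product_times_vector
            flip: scaleR_matrix_vector_assoc)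
      also have "\<dots> = (\<Sum>e\<in>E. if e = b then c b *\<^sub>R b else 0)"
        using E(1) unit b by (intro sum.cong) (auto simp: pairwise_def orthogonal_def norm_eq_1)
      finally show "Y *v b = (\<Sum>e\<in>E. c e *\<^sub>R outer_product e) *v b"
        using c b fin by simp
    qed (auto intro: matrix_vector_mul_linear)
  qed
  then have "Y = (\<Sum>e\<in>E. c e *\<^sub>R outer_product e)" by (simp add: matrix_eq)
  with fin unit nn show ?thesis by (intro that)
qed

text \<open>Writing \<open>Y\<close> as a nonnegative combination of projections \<open>e e\<^sup>T\<close> turns \<open>\<langle>Y, N\<rangle>\<close> into a nonnegative
combination of values \<open>e \<bullet> N e\<close>.\<close>
lemma psd_inner_nonneg:
  assumes "psd Y" "psd N"
  shows "0 \<le> Y \<bullet> N"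
proof -
  obtain E c where E: "finite E" "\<And>e. e \<in> E \<Longrightarrow> 0 \<le> c e"
    "Y = (\<Sum>e\<in>E. c e *\<^sub>R outer_product e)"
    using psd_sum_outer_products[OF assms(1)] by metis
  show ?thesis unfolding E(3)
    using E(2) assms(2)
    by (auto simp: inner_sum_left inner_outer_product psd_def intro!: sum_nonneg mult_nonneg_nonneg)
qed

text \<open>In \<open>\<langle>Y, N\<rangle> = \<Sum> c\<^sub>e (e \<bullet> N e)\<close> every summand must vanish, so each \<open>e\<close> with \<open>c\<^sub>e \<noteq> 0\<close> lies in the
kernel of \<open>N\<close>. Hence \<open>e \<bullet> N u = N e \<bullet> u = 0\<close> for all \<open>u\<close>.\<close>
lemma psd_complementary_product_zero:
  fixes Y N :: "real^'m^'m"
  assumes "psd Y" "psd N" "Y \<bullet> N = 0"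
  shows "Y ** N = 0"
proof -
  obtain E c where E: "finite E" "\<And>e. e \<in> E \<Longrightarrow> 0 \<le> c e"
    "Y = (\<Sum>e\<in>E. c e *\<^sub>R outer_product e)"
    using psd_sum_outer_products[OF assms(1)] by metis
  have "(\<Sum>e\<in>E. c e * (e \<bullet> (N *v e))) = 0"
    using assms(3) unfolding E(3) by (simp add: inner_sum_left inner_outer_product)
  then have zero: "c e = 0 \<or> N *v e = 0" if "e \<in> E" for e
    using E assms(2) that psd_vanishing_form[OF assms(2), of e]
    by (subst (asm) sum_nonneg_eq_0_iff) (auto simp: psd_def)
  have "(Y ** N) *v u = 0" for u
  proof -
    have "(Y ** N) *v u = (\<Sum>e\<in>E. (c e * (e \<bullet> (N *v u))) *\<^sub>R e)"
      unfolding matrix_vector_mul_assoc[symmetric] E(3)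
      by (simp add: sum_matrix_times_vector outer_product_times_vector
          flip: scaleR_matrix_vector_assoc)
    also have "\<dots> = 0"
    proof (intro sum.neutral ballI)
      fix e assume "e \<in> E"
      have "e \<bullet> (N *v u) = u \<bullet> (N *v e)"
        using assms(2) by (intro symmetric_matrix_inner_commute) (simp add: psd_def)
      then show "(c e * (e \<bullet> (N *v u))) *\<^sub>R e = 0" using zero[OF \<open>e \<in> E\<close>] by auto
    qed
    finally show ?thesis .
  qed
  then show ?thesis by (simp add: matrix_eq)
qed

lemma trace_eq_inner_mat: "trace A = A \<bullet> mat 1"
  by (simp add: trace_def inner_vec_def mat_def if_distrib sum.delta cong: if_cong)

text \<open>The projections \<open>e e\<^sup>T\<close> have norm and trace \<open>1\<close>. This is what turns the bound on the trace of
a multiplier into a bound on the multiplier.\<close>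
lemma norm_psd_le_trace:
  assumes "psd Y"
  shows "norm Y \<le> trace Y"
proof -
  obtain E c where E: "finite E" "\<And>e. e \<in> E \<Longrightarrow> norm e = 1" "\<And>e. e \<in> E \<Longrightarrow> 0 \<le> c e"
    "Y = (\<Sum>e\<in>E. c e *\<^sub>R outer_product e)"
    using psd_sum_outer_products[OF assms(1)] by metis
  have "norm Y \<le> (\<Sum>e\<in>E. norm (c e *\<^sub>R outer_product e))"
    unfolding E(4) by (rule norm_sum)
  also have "\<dots> = (\<Sum>e\<in>E. c e)"
    using E by (intro sum.cong) (auto simp: norm_outer_product)
  also have "\<dots> = trace Y"
    unfolding trace_eq_inner_mat E(4) using E(2)
    by (auto simp: inner_sum_left inner_outer_product norm_eq_1 intro!: sum.cong)
  finally show ?thesis .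
qed

lemma psd_trace_nonneg: "psd (Y :: real^'m^'m) \<Longrightarrow> 0 \<le> trace Y"
  using norm_psd_le_trace[of Y] norm_ge_zero[of Y] by linarith

section \<open>Norms and limits of matrices\<close>

text \<open>Cauchy--Schwarz for the form of \<open>B\<close>, applied to \<open>B u\<close> and \<open>u\<close>, bounds \<open>\<parallel>B u\<parallel>\<^sup>4\<close> by
\<open>c \<parallel>B u\<parallel>\<^sup>2 c \<parallel>u\<parallel>\<^sup>2\<close>.\<close>
lemma psd_norm_le:
  fixes B :: "real^'n^'n"
  assumes B: "psd B" and upper: "\<And>u. u \<bullet> (B *v u) \<le> c * (norm u)\<^sup>2" and c: "0 \<le> c"
  shows "norm (B *v u) \<le> c * norm u"
proof (cases "B *v u = 0")
  case True
  then show ?thesis using c by simp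
next
  case False
  let ?w = "B *v u"
  have "(?w \<bullet> ?w)\<^sup>2 \<le> (?w \<bullet> (B *v ?w)) * (u \<bullet> (B *v u))"
    using B by (intro nonneg_form_Cauchy_Schwarz[where S = UNIV]) (auto simp: psd_def)
  also have "\<dots> \<le> (c * (norm ?w)\<^sup>2) * (c * (norm u)\<^sup>2)"
    using B c by (intro mult_mono upper) (auto simp: psd_def)
  finally have "(norm ?w)\<^sup>2 * (norm ?w)\<^sup>2 \<le> (norm ?w)\<^sup>2 * (c * norm u)\<^sup>2"
    by (simp add: power2_norm_eq_inner[symmetric] power2_eq_square ac_simps)
  then have "(norm ?w)\<^sup>2 \<le> (c * norm u)\<^sup>2"
    using False by (subst (asm) mult_le_cancel_left_pos) simp_all
  then show ?thesis by (rule power2_le_imp_le) (use c in simp)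
qed

lemma norm_transpose: "norm (transpose A) = norm (A :: real^'m^'n)"
proof -
  have "transpose A \<bullet> transpose A = A \<bullet> A"
    unfolding inner_vec_def transpose_def by (simp, rule sum.swap)
  then show ?thesis by (simp add: norm_eq_sqrt_inner)
qed

lemma norm_matrix_matrix_le: "norm (A ** B) \<le> norm A * norm (B :: real^'m^'m)"
  for A :: "real^'m^'m"
proof -
  have row: "(A ** B) $ i = transpose B *v (A $ i)" for i
    by (simp add: vec_eq_iff matrix_matrix_mult_def matrix_vector_mult_def transpose_def ac_simps
        del: transpose_matrix_vector)
  have "norm (A ** B) \<le> norm (\<chi> i. norm (A $ i) * norm B)"
    unfolding norm_vec_def[of "A ** B"] norm_vec_def[of "\<chi> i. norm (A $ i) * norm B"]
  proof (rule L2_set_mono)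
    show "norm ((A ** B) $ i) \<le> norm ((\<chi> i. norm (A $ i) * norm B) $ i)" for i
      using norm_matrix_vector_le[of "transpose B" "A $ i"]
      by (simp add: row norm_transpose ac_simps del: transpose_matrix_vector)
  qed simp
  also have "\<dots> = norm A * norm B"
    by (simp add: norm_vec_def[of A] norm_vec_def[of "\<chi> i. norm (A $ i) * norm B"]
        L2_set_left_distrib)
  finally show ?thesis .
qed

lemma matrix_mult_mat: "Y ** mat c = c *\<^sub>R (Y :: real^'m^'m)"
  by (simp add: vec_eq_iff matrix_matrix_mult_def mat_def if_distrib[of "\<lambda>z. _ * z"]
      sum.delta cong: if_cong)

lemma tendsto_matrix_vector_mult:
  fixes a :: "real^'m^'n"
  assumes "(A \<longlongrightarrow> a) F" "(u \<longlongrightarrow> w) F"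
  shows "((\<lambda>k. A k *v u k) \<longlongrightarrow> a *v w) F"
  unfolding matrix_vector_mult_def
  by (intro tendsto_vec_lambda tendsto_sum tendsto_mult tendsto_vec_nth assms)

lemma tendsto_transpose:
  fixes a :: "real^'m^'n"
  assumes "(A \<longlongrightarrow> a) F"
  shows "((\<lambda>k. transpose (A k)) \<longlongrightarrow> transpose a) F"
  unfolding transpose_def
  by (intro tendsto_vec_lambda tendsto_vec_nth assms)

lemma psd_limit:
  fixes a :: "real^'m^'m"
  assumes lim: "(A \<longlongrightarrow> a) F" and F: "F \<noteq> bot" and psd: "\<And>k. psd (A k)"
  shows "psd a"
proof -
  have "((\<lambda>k. transpose (A k)) \<longlongrightarrow> transpose a) F" by (rule tendsto_transpose[OF lim])
  moreover have "(\<lambda>k. transpose (A k)) = A"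
    using psd by (auto simp: psd_def symmetric_matrix_def)
  ultimately have "(A \<longlongrightarrow> transpose a) F" by (simp only:)
  then have "symmetric_matrix a"
    unfolding symmetric_matrix_def by (rule tendsto_unique[OF F _ lim])
  moreover have "0 \<le> u \<bullet> (a *v u)" for u
  proof (rule tendsto_lowerbound[OF _ _ F])
    show "((\<lambda>k. u \<bullet> (A k *v u)) \<longlongrightarrow> u \<bullet> (a *v u)) F"
      by (intro tendsto_inner tendsto_const tendsto_matrix_vector_mult lim)
    show "\<forall>\<^sub>F k in F. 0 \<le> u \<bullet> (A k *v u)" using psd by (simp add: psd_def)
  qed
  ultimately show ?thesis by (simp add: psd_def)
qed

lemma pos_def_imp_psd: "pos_def A \<Longrightarrow> psd A"
  unfolding pos_def_def psd_def by (metis inner_zero_left less_eq_real_def)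

section \<open>Derivatives and errors of linearization\<close>

text \<open>On a ball the second derivative is bounded by compactness, so the first derivative is Lipschitz
there; the mean value inequality on the segment from \<open>x\<close> to \<open>x + e\<close>, which stays in the ball, then gives the
quadratic remainder.\<close>
lemma twice_continuously_differentiable_quadratic_bound:
  fixes \<phi> :: "'a::euclidean_space \<Rightarrow> 'b::real_normed_vector"
  assumes "twice_continuously_differentiable \<phi>"
  obtains \<phi>' :: "'a \<Rightarrow> 'a \<Rightarrow>\<^sub>L 'b" where
    "\<forall>x. (\<phi> has_derivative blinfun_apply (\<phi>' x)) (at x)"
    "continuous_on UNIV \<phi>'"
    "\<forall>R. \<exists>C\<ge>0. \<forall>x e. norm x \<le> R \<longrightarrow> norm (x + e) \<le> R \<longrightarrow>
       norm (\<phi> (x + e) - \<phi> x - \<phi>' x e) \<le> C * (norm e)\<^sup>2"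
proof -
  obtain \<phi>' :: "'a \<Rightarrow> 'a \<Rightarrow>\<^sub>L 'b" and \<phi>'' :: "'a \<Rightarrow> 'a \<Rightarrow>\<^sub>L ('a \<Rightarrow>\<^sub>L 'b)" where
    d1: "\<And>x. (\<phi> has_derivative blinfun_apply (\<phi>' x)) (at x)" and
    d2: "\<And>x. (\<phi>' has_derivative blinfun_apply (\<phi>'' x)) (at x)" and
    cont: "continuous_on UNIV \<phi>''"
    using assms unfolding twice_continuously_differentiable_def by (elim exE conjE) (rule that, auto)
  have "continuous_on UNIV \<phi>'"
    using d2 by (meson has_derivative_continuous continuous_at_imp_continuous_on)
  moreover have "\<exists>C\<ge>0. \<forall>x e. norm x \<le> R \<longrightarrow> norm (x + e) \<le> R \<longrightarrow>
       norm (\<phi> (x + e) - \<phi> x - \<phi>' x e) \<le> C * (norm e)\<^sup>2" for R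
  proof -
    have "compact (\<phi>'' ` cball 0 R)"
      using cont by (intro compact_continuous_image) (auto intro: continuous_on_subset)
    then have "bounded (\<phi>'' ` cball 0 R)" by (rule compact_imp_bounded)
    then obtain C where C0: "0 < C" "\<forall>z\<in>\<phi>'' ` cball 0 R. norm z \<le> C"
      unfolding bounded_pos by (elim exE conjE)
    then have C: "0 < C" "\<And>x. x \<in> cball 0 R \<Longrightarrow> norm (\<phi>'' x) \<le> C"
      by simp_all
    have lip: "norm (\<phi>' y - \<phi>' x) \<le> C * norm (y - x)"
      if "y \<in> cball 0 R" "x \<in> cball 0 R" for x y
      using that C(2) 
      by (intro differentiable_bound[where S = "cball 0 R" and f' = "\<lambda>x. blinfun_apply (\<phi>'' x)"])
        (auto simp: norm_blinfun.rep_eq[symmetric] intro: has_derivative_at_withinI[OF d2])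
    have "norm (\<phi> (x + e) - \<phi> x - \<phi>' x e) \<le> C * (norm e)\<^sup>2"
      if x: "norm x \<le> R" "norm (x + e) \<le> R" for x e
    proof -
      let ?S = "closed_segment x (x + e)"
      have sub: "?S \<subseteq> cball 0 R" using x by (intro closed_segment_subset) auto
      have "norm (\<phi> (x + e) - \<phi> x - \<phi>' x ((x + e) - x)) \<le> norm ((x + e) - x) * (C * norm e)"
      proof (rule differentiable_bound_linearization[where S = ?S and
            f' = "\<lambda>z. blinfun_apply (\<phi>' z)"])
        show "x + \<tau> *\<^sub>R (x + e - x) \<in> ?S" if "\<tau> \<in> {0..1}" for \<tau>
          using that unfolding closed_segment_def
          by (auto intro!: exI[of _ \<tau>] simp: algebra_simps)
        show "(\<phi> has_derivative blinfun_apply (\<phi>' z)) (at z within ?S)" for z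
          by (rule has_derivative_at_withinI[OF d1])
        show "onorm (blinfun_apply (\<phi>' z) - blinfun_apply (\<phi>' x)) \<le> C * norm e" if z: "z \<in> ?S" for z
        proof -
          have "norm (\<phi>' z - \<phi>' x) \<le> C * norm (z - x)"
            using z sub by (intro lip) auto
          also have "\<dots> \<le> C * norm e"
            using C(1) segment_bound1[OF z] by (intro mult_left_mono) auto
          finally show ?thesis by (simp add: norm_blinfun.rep_eq minus_blinfun.rep_eq fun_diff_def)
        qed
      qed auto
      then show ?thesis by (simp add: power2_eq_square ac_simps)
    qed
    then show ?thesis using C(1) by (intro exI[of _ C]) auto
  qed
  ultimately show ?thesis using d1 by (intro that[of \<phi>']) auto
qed

lemma grad_eqI:
  assumes "GDERIV \<phi> x :> D"
  shows "grad \<phi> x = D"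
  unfolding grad_def
proof (rule the_equality)
  show "GDERIV \<phi> x :> D" by (rule assms)
next
  fix D' assume "GDERIV \<phi> x :> D'"
  then have "(\<lambda>u. u \<bullet> D') = (\<lambda>u. u \<bullet> D)"
    using assms unfolding gderiv_def by (rule has_derivative_unique)
  from fun_cong[OF this, of "D' - D"] have "(D' - D) \<bullet> (D' - D) = 0"
    by (simp add: inner_diff_right)
  then show "D' = D" by simp
qed

lemma linear_eq_sum_axis:
  assumes "linear (L :: real^'n \<Rightarrow> 'b::real_vector)"
  shows "L u = (\<Sum>i\<in>UNIV. u $ i *\<^sub>R L (axis i 1))"
proof -
  have "L u = L (\<Sum>i\<in>UNIV. u $ i *\<^sub>R axis i 1)"
    by (simp add: basis_expansion flip: scalar_mult_eq_scaleR)
  then show ?thesis by (simp add: linear_sum[OF assms] linear_scale[OF assms])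
qed

lemma derivative_eq_inner_grad:
  assumes "(\<phi> has_derivative \<phi>') (at (x :: real^'n))"
  shows "\<phi>' u = grad \<phi> x \<bullet> u" "grad \<phi> x = (\<chi> i. \<phi>' (axis i 1))"
proof -
  let ?D = "\<chi> i. \<phi>' (axis i 1)"
  have *: "\<phi>' u = u \<bullet> ?D" for u
    using linear_eq_sum_axis[OF has_derivative_linear[OF assms], of u]
    by (simp add: inner_vec_def)
  then have eq: "\<phi>' = (\<lambda>u. u \<bullet> ?D)" by (rule ext)
  have "GDERIV \<phi> x :> ?D"
    unfolding gderiv_def using assms eq by (rule has_derivative_eq_rhs)
  then show g: "grad \<phi> x = ?D" by (rule grad_eqI)
  show "\<phi>' u = grad \<phi> x \<bullet> u" unfolding g by (subst inner_commute) (rule *)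
qed

lemma has_derivative_jacobian:
  fixes \<phi> :: "real^'n \<Rightarrow> real^'l"
  assumes "(\<phi> has_derivative \<phi>') (at x)"
  shows "jacobian \<phi> (at x) *v u = \<phi>' u"
proof -
  have "(\<phi> has_derivative (*v) (jacobian \<phi> (at x))) (at x)"
    using differentiableI[OF assms] by (rule iffD1[OF jacobian_works])
  from has_derivative_unique[OF this assms] show ?thesis by (rule fun_cong)
qed

lemma partial_deriv_eq_derivative:
  assumes "(\<phi> has_derivative \<phi>') (at x)"
  shows "partial_deriv \<phi> x i = \<phi>' (axis i 1)"
proof -
  have "((\<lambda>\<tau>. \<phi> (x + \<tau> *\<^sub>R axis i 1)) has_derivative (\<lambda>\<tau>. \<phi>' (\<tau> *\<^sub>R axis i 1))) (at 0)"
    using assms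
    by (intro has_derivative_compose[where g = \<phi> and g' = \<phi>' and f = "\<lambda>\<tau>. x + \<tau> *\<^sub>R axis i 1"])
      (auto intro!: derivative_eq_intros)
  then have "((\<lambda>\<tau>. \<phi> (x + \<tau> *\<^sub>R axis i 1)) has_vector_derivative \<phi>' (axis i 1)) (at 0)"
    using has_derivative_linear[OF assms]
    by (simp add: has_vector_derivative_def linear_scale)
  then show ?thesis unfolding partial_deriv_def by (rule vector_derivative_at)
qed

lemma DG_apply_eq_derivative:
  assumes "(G has_derivative G') (at x)"
  shows "DG_apply G x u = G' u"
  unfolding DG_apply_def partial_deriv_eq_derivative[OF assms]
  by (rule linear_eq_sum_axis[OF has_derivative_linear[OF assms], symmetric])

text \<open>Transposition is linear and fixes every value of \<open>G\<close>, hence it fixes the derivative.\<close>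
lemma derivative_of_symmetric_matrices_symmetric:
  fixes G :: "'a::real_normed_vector \<Rightarrow> real^'m^'m"
  assumes "(G has_derivative G') (at x)" "\<And>z. symmetric_matrix (G z)"
  shows "symmetric_matrix (G' u)"
proof -
  have "linear (transpose :: real^'m^'m \<Rightarrow> real^'m^'m)"
    by (rule linearI) (simp_all add: transpose_def vec_eq_iff)
  then have "bounded_linear (transpose :: real^'m^'m \<Rightarrow> real^'m^'m)"
    by (simp add: linear_conv_bounded_linear)
  then have "((\<lambda>z. transpose (G z)) has_derivative (\<lambda>u. transpose (G' u))) (at x)"
    using assms(1) by (rule bounded_linear.has_derivative)
  moreover have "(\<lambda>z. transpose (G z)) = G"
    using assms(2) by (auto simp: symmetric_matrix_def)
  ultimately have "(\<lambda>u. transpose (G' u)) = G'"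
    using assms(1) by (simp add: has_derivative_unique)
  from fun_cong[OF this] show ?thesis unfolding symmetric_matrix_def .
qed

lemma inner_DG_adjoint:
  assumes "\<And>i. symmetric_matrix (partial_deriv G x i)"
  shows "u \<bullet> DG_adjoint G x Y = DG_apply G x u \<bullet> Y"
  by (simp add: inner_vec_def[of u] DG_adjoint_def DG_apply_def trace_inner_eq_inner[OF assms]
      inner_sum_left)

lemma inner_transpose_vector: "u \<bullet> (transpose J *v w) = (J *v u) \<bullet> (w :: real^'m)"
  by (metis dot_lmul_matrix inner_commute transpose_matrix_vector)

lemma grad_fritz_john:
  fixes f :: "real^'n \<Rightarrow> real" and h :: "real^'n \<Rightarrow> real^'l" and G :: "real^'n \<Rightarrow> real^'m^'m"
  assumes f: "(f has_derivative f') (at x)" and h: "(h has_derivative h') (at x)"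
    and G: "(G has_derivative G') (at x)" and sym: "\<And>z. symmetric_matrix (G z)"
  shows "grad (\<lambda>z. fritz_john f h G z \<rho> \<mu> Y) x
    = \<rho> *\<^sub>R grad f x + transpose (jacobian h (at x)) *v \<mu> + DG_adjoint G x Y"
proof (rule grad_eqI)
  have s: "symmetric_matrix (partial_deriv G x i)" for i
    unfolding partial_deriv_eq_derivative[OF G]
    by (rule derivative_of_symmetric_matrices_symmetric[OF G sym])
  have "((\<lambda>z. \<rho> * f z + \<mu> \<bullet> h z + Y \<bullet> G z) has_derivative
      (\<lambda>u. \<rho> * f' u + \<mu> \<bullet> h' u + Y \<bullet> G' u)) (at x)"
    by (intro derivative_intros f h G)
  also have "(\<lambda>u. \<rho> * f' u + \<mu> \<bullet> h' u + Y \<bullet> G' u) = (\<lambda>u. u \<bullet> (\<rho> *\<^sub>R grad f x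
      + transpose (jacobian h (at x)) *v \<mu> + DG_adjoint G x Y))"
    by (simp add: inner_right_distrib inner_DG_adjoint[OF s] inner_transpose_vector fun_eq_iff
        del: transpose_matrix_vector add: derivative_eq_inner_grad(1)[OF f] has_derivative_jacobian[OF h]
        DG_apply_eq_derivative[OF G] inner_commute)
  finally show "GDERIV (\<lambda>z. fritz_john f h G z \<rho> \<mu> Y) x :> \<rho> *\<^sub>R grad f x
      + transpose (jacobian h (at x)) *v \<mu> + DG_adjoint G x Y"
    unfolding gderiv_def fritz_john_def trace_inner_eq_inner[OF sym] .
qed

lemma norm1_add_le: "norm1 (a + b) \<le> norm1 a + norm1 b"
  unfolding norm1_def sum.distrib[symmetric] by (intro sum_mono) (simp add: abs_triangle_ineq)

lemma norm1_scaleR: "norm1 (c *\<^sub>R a) = \<bar>c\<bar> * norm1 a"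
  by (simp add: norm1_def abs_mult sum_distrib_left)

lemma norm1_nonneg: "0 \<le> norm1 a"
  by (simp add: norm1_def sum_nonneg)

lemma norm1_le_norm: "norm1 (a :: real^'l) \<le> real CARD('l) * norm a"
  unfolding norm1_def using sum_bounded_above[of UNIV "\<lambda>i. \<bar>a $ i\<bar>" "norm a"]
  by (simp add: component_le_norm_cart)

lemma inner_le_infnorm_norm1: "\<bar>a \<bullet> b\<bar> \<le> infnorm a * norm1 (b :: real^'l)"
proof -
  have "\<bar>a \<bullet> b\<bar> \<le> (\<Sum>i\<in>UNIV. \<bar>a $ i\<bar> * \<bar>b $ i\<bar>)"
    unfolding inner_vec_def using sum_abs[of "\<lambda>i. a $ i * b $ i" UNIV] by (simp add: abs_mult)
  also have "\<dots> \<le> (\<Sum>i\<in>UNIV. infnorm a * \<bar>b $ i\<bar>)"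
    by (intro sum_mono mult_right_mono component_le_infnorm_cart) simp
  finally show ?thesis by (simp add: norm1_def sum_distrib_left)
qed

lemma norm_le_norm1: "norm (a :: real^'l) \<le> norm1 a"
  unfolding norm1_def by (rule norm_le_l1_cart)

lemma viol_nonneg: "0 \<le> viol h G z"
  by (simp add: viol_def norm1_nonneg add_nonneg_nonneg)

lemma lin_viol_zero: "lin_viol h G x 0 = viol h G x"
  by (simp add: lin_viol_def viol_def lin_h_def lin_G_def DG_apply_def)

text \<open>The part of the setting that concerns the problem alone, without reference to an algorithm.\<close>
locale smooth_problem =
  fixes f :: "real^'n \<Rightarrow> real"
    and h :: "real^'n \<Rightarrow> real^'l"
    and G :: "real^'n \<Rightarrow> real^'m^'m"
  assumes smooth_f: "twice_continuously_differentiable f"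
    and smooth_h: "twice_continuously_differentiable h"
    and smooth_G: "twice_continuously_differentiable G"
    and G_sym: "symmetric_matrix (G z)"
begin

lemma problem_data_differentiable:
  obtains f' h' G' where
    "(f has_derivative f') (at x)" "(h has_derivative h') (at x)" "(G has_derivative G') (at x)"
proof -
  from smooth_f smooth_h smooth_G obtain f' h' G' where
    "(f has_derivative blinfun_apply (f' x)) (at x)"
    "(h has_derivative blinfun_apply (h' x)) (at x)"
    "(G has_derivative blinfun_apply (G' x)) (at x)"
    unfolding twice_continuously_differentiable_def by (elim exE conjE) (rule that, auto)
  then show ?thesis by (rule that)
qed

lemma symmetric_partial_deriv: "symmetric_matrix (partial_deriv G x i)"
proof -
  obtain f' h' G' where "(f has_derivative f') (at x)" "(h has_derivative h') (at x)"
    and G: "(G has_derivative G') (at x)" by (rule problem_data_differentiable)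
  show ?thesis
    unfolding partial_deriv_eq_derivative[OF G]
    by (rule derivative_of_symmetric_matrices_symmetric[OF G G_sym])
qed

lemma symmetric_DG_apply: "symmetric_matrix (DG_apply G x u)"
proof -
  obtain f' h' G' where "(f has_derivative f') (at x)" "(h has_derivative h') (at x)"
    and G: "(G has_derivative G') (at x)" by (rule problem_data_differentiable)
  show ?thesis
    unfolding DG_apply_eq_derivative[OF G]
    by (rule derivative_of_symmetric_matrices_symmetric[OF G G_sym])
qed

lemma symmetric_lin_G: "symmetric_matrix (lin_G G x u)"
  by (simp add: lin_G_def symmetric_matrix_algebra symmetric_DG_apply G_sym)

lemma isCont_problem_data:
  "isCont f x" "isCont h x" "isCont G x" "isCont (grad f) x"
  "isCont (\<lambda>z. jacobian h (at z)) x" "isCont (\<lambda>z. partial_deriv G z i) x"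
proof -
  from smooth_f obtain f' where f: "\<forall>x. (f has_derivative blinfun_apply (f' x)) (at x)"
    "continuous_on UNIV f'" by (rule twice_continuously_differentiable_quadratic_bound)
  from smooth_h obtain h' where h: "\<forall>x. (h has_derivative blinfun_apply (h' x)) (at x)"
    "continuous_on UNIV h'" by (rule twice_continuously_differentiable_quadratic_bound)
  from smooth_G obtain G' where G: "\<forall>x. (G has_derivative blinfun_apply (G' x)) (at x)"
    "continuous_on UNIV G'" by (rule twice_continuously_differentiable_quadratic_bound)
  show "isCont f x" "isCont h x" "isCont G x"
    using f(1) h(1) G(1) has_derivative_continuous by blast+
  have c: "isCont f' x" "isCont h' x" "isCont G' x"
    using f(2) h(2) G(2) by (auto simp: continuous_on_eq_continuous_at)
  have "grad f = (\<lambda>z. \<chi> i. f' z (axis i 1))"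
    using f(1) derivative_eq_inner_grad(2) by blast
  moreover have "isCont (\<lambda>z. \<chi> i. f' z (axis i 1)) x"
    using c(1) unfolding isCont_def by (intro tendsto_vec_lambda blinfun.tendsto tendsto_const)
  ultimately show "isCont (grad f) x" by simp
  have "jacobian h (at z) $ i $ j = h' z (axis j 1) $ i" for z i j
    using has_derivative_jacobian[OF h(1)[rule_format], of z "axis j 1"]
    by (simp add: matrix_vector_mult_basis column_def vec_eq_iff)
  then have "(\<lambda>z. jacobian h (at z)) = (\<lambda>z. \<chi> i j. h' z (axis j 1) $ i)"
    by (simp add: vec_eq_iff fun_eq_iff)
  moreover have "isCont (\<lambda>z. \<chi> i j. h' z (axis j 1) $ i) x"
    using c(2) unfolding isCont_def
    by (intro tendsto_vec_lambda tendsto_vec_nth blinfun.tendsto tendsto_const)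
  ultimately show "isCont (\<lambda>z. jacobian h (at z)) x" by simp
  have "(\<lambda>z. partial_deriv G z i) = (\<lambda>z. G' z (axis i 1))"
    using G(1) partial_deriv_eq_derivative by blast
  moreover have "isCont (\<lambda>z. G' z (axis i 1)) x"
    using c(3) unfolding isCont_def by (intro blinfun.tendsto tendsto_const)
  ultimately show "isCont (\<lambda>z. partial_deriv G z i) x" by simp
qed

text \<open>The violation measure is Lipschitz in the values of \<open>h\<close> and \<open>G\<close>: the largest eigenvalue is
subadditive and at most the norm. So the quadratic remainders of \<open>h\<close> and \<open>G\<close>
carry over to \<open>viol\<close>, although it is not differentiable.\<close>
lemma linearization_errors:
  "\<exists>C\<ge>0. \<forall>x e. norm x \<le> R \<longrightarrow> norm (x + e) \<le> R \<longrightarrow>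
     f (x + e) - f x - grad f x \<bullet> e \<le> C * (norm e)\<^sup>2 \<and>
     viol h G (x + e) - lin_viol h G x e \<le> C * (norm e)\<^sup>2"
proof -
  from smooth_f obtain f' where f: "\<forall>x. (f has_derivative blinfun_apply (f' x)) (at x)"
    "\<forall>R. \<exists>C\<ge>0. \<forall>x e. norm x \<le> R \<longrightarrow> norm (x + e) \<le> R \<longrightarrow>
       norm (f (x + e) - f x - f' x e) \<le> C * (norm e)\<^sup>2"
    by (rule twice_continuously_differentiable_quadratic_bound)
  from smooth_h obtain h' where h: "\<forall>x. (h has_derivative blinfun_apply (h' x)) (at x)"
    "\<forall>R. \<exists>C\<ge>0. \<forall>x e. norm x \<le> R \<longrightarrow> norm (x + e) \<le> R \<longrightarrow>
       norm (h (x + e) - h x - h' x e) \<le> C * (norm e)\<^sup>2"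
    by (rule twice_continuously_differentiable_quadratic_bound)
  from smooth_G obtain G' where G: "\<forall>x. (G has_derivative blinfun_apply (G' x)) (at x)"
    "\<forall>R. \<exists>C\<ge>0. \<forall>x e. norm x \<le> R \<longrightarrow> norm (x + e) \<le> R \<longrightarrow>
       norm (G (x + e) - G x - G' x e) \<le> C * (norm e)\<^sup>2"
    by (rule twice_continuously_differentiable_quadratic_bound)
  obtain Cf Ch CG where nn: "0 \<le> Cf" "0 \<le> Ch" "0 \<le> CG" and
    bf: "\<And>x e. norm x \<le> R \<Longrightarrow> norm (x + e) \<le> R \<Longrightarrow>
       norm (f (x + e) - f x - f' x e) \<le> Cf * (norm e)\<^sup>2" and
    bh: "\<And>x e. norm x \<le> R \<Longrightarrow> norm (x + e) \<le> R \<Longrightarrow>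
       norm (h (x + e) - h x - h' x e) \<le> Ch * (norm e)\<^sup>2" and
    bG: "\<And>x e. norm x \<le> R \<Longrightarrow> norm (x + e) \<le> R \<Longrightarrow>
       norm (G (x + e) - G x - G' x e) \<le> CG * (norm e)\<^sup>2"
    using f(2)[rule_format, of R] h(2)[rule_format, of R] G(2)[rule_format, of R] by metis
  let ?C = "Cf + real CARD('l) * Ch + CG"
  have "f (x + e) - f x - grad f x \<bullet> e \<le> ?C * (norm e)\<^sup>2 \<and>
     viol h G (x + e) - lin_viol h G x e \<le> ?C * (norm e)\<^sup>2"
    if x: "norm x \<le> R" "norm (x + e) \<le> R" for x e
  proof
    have "f (x + e) - f x - grad f x \<bullet> e \<le> Cf * (norm e)\<^sup>2"
      using bf[OF x] derivative_eq_inner_grad(1)[OF f(1)[rule_format]] by (simp add: abs_le_iff)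
    also have "\<dots> \<le> ?C * (norm e)\<^sup>2" using nn by (intro mult_right_mono) auto
    finally show "f (x + e) - f x - grad f x \<bullet> e \<le> ?C * (norm e)\<^sup>2" .
    define E where "E = G (x + e) - lin_G G x e"
    have E: "symmetric_matrix E" "norm E \<le> CG * (norm e)\<^sup>2"
      using bG[OF x] unfolding E_def
      by (simp_all add: symmetric_matrix_algebra(2) symmetric_lin_G G_sym)
        (simp add: lin_G_def DG_apply_eq_derivative[OF G(1)[rule_format]] diff_diff_add)
    have "lambda_max (G (x + e)) = lambda_max (lin_G G x e + E)" by (simp add: E_def)
    also have "\<dots> \<le> lambda_max (lin_G G x e) + lambda_max E"
      by (rule lambda_max_add_le[OF symmetric_lin_G E(1)])
    also have "lambda_max E \<le> norm E" by (rule lambda_max_le_norm[OF E(1)])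
    finally have l: "lambda_max (G (x + e)) \<le> lambda_max (lin_G G x e) + CG * (norm e)\<^sup>2"
      using E(2) by simp
    have "norm1 (h (x + e)) = norm1 (lin_h h x e + (h (x + e) - lin_h h x e))" by simp
    also have "\<dots> \<le> norm1 (lin_h h x e) + norm1 (h (x + e) - lin_h h x e)" by (rule norm1_add_le)
    also have "norm1 (h (x + e) - lin_h h x e) \<le> real CARD('l) * norm (h (x + e) - lin_h h x e)"
      by (rule norm1_le_norm)
    also have "\<dots> \<le> real CARD('l) * (Ch * (norm e)\<^sup>2)"
      using bh[OF x] by (intro mult_left_mono)
        (auto simp: lin_h_def has_derivative_jacobian[OF h(1)[rule_format]] diff_diff_add)
    finally have n: "norm1 (h (x + e)) \<le> norm1 (lin_h h x e) + real CARD('l) * Ch * (norm e)\<^sup>2"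
      by simp
    have "0 \<le> Cf * (norm e)\<^sup>2" "0 \<le> CG * (norm e)\<^sup>2" using nn by simp_all
    with l n show "viol h G (x + e) - lin_viol h G x e \<le> ?C * (norm e)\<^sup>2"
      unfolding viol_def lin_viol_def distrib_right by linarith
  qed
  moreover have "0 \<le> ?C" using nn by simp
  ultimately show ?thesis by blast
qed

text \<open>The linearizations are affine in the step, and both \<open>norm1\<close> and \<open>[\<lambda>\<^sub>1]\<^sub>+\<close> are subadditive and
positively homogeneous. At the zero step the linearized violation is the violation itself.\<close>
lemma lin_viol_convex:
  assumes "0 \<le> a" "a \<le> 1"
  shows "lin_viol h G x (a *\<^sub>R u) \<le> (1 - a) * viol h G x + a * lin_viol h G x u"
proof -
  have "lin_h h x (a *\<^sub>R u) = (1 - a) *\<^sub>R h x + a *\<^sub>R lin_h h x u"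
    by (simp add: lin_h_def matrix_vector_mult_scaleR algebra_simps)
  then have n: "norm1 (lin_h h x (a *\<^sub>R u)) \<le> (1 - a) * norm1 (h x) + a * norm1 (lin_h h x u)"
    using norm1_add_le[of "(1 - a) *\<^sub>R h x" "a *\<^sub>R lin_h h x u"] assms by (simp add: norm1_scaleR)
  have "lin_G G x (a *\<^sub>R u) = (1 - a) *\<^sub>R G x + a *\<^sub>R lin_G G x u"
    by (simp add: lin_G_def DG_apply_def algebra_simps scaleR_sum_right)
  then have "lambda_max (lin_G G x (a *\<^sub>R u))
      \<le> lambda_max ((1 - a) *\<^sub>R G x) + lambda_max (a *\<^sub>R lin_G G x u)"
    by (simp add: lambda_max_add_le symmetric_matrix_algebra G_sym symmetric_lin_G)
  also have "\<dots> \<le> (1 - a) * lambda_max (G x) + a * lambda_max (lin_G G x u)"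
    using assms by (intro add_mono lambda_max_scaleR G_sym symmetric_lin_G) auto
  also have "\<dots> \<le> (1 - a) * max 0 (lambda_max (G x)) + a * max 0 (lambda_max (lin_G G x u))"
    using assms by (intro add_mono mult_left_mono) auto
  finally have "max 0 (lambda_max (lin_G G x (a *\<^sub>R u))) \<le> \<dots>"
    using assms by auto
  with n show ?thesis
    unfolding lin_viol_def viol_def by (simp add: algebra_simps)
qed

text \<open>The predicted decrease is the true one up to a second-order term in the step length. This is what makes
the line search accept step lengths that are not too small.\<close>
lemma penalty_decrease:
  "\<exists>C\<ge>0. \<forall>x u a. norm x \<le> R \<longrightarrow> norm (x + a *\<^sub>R u) \<le> R \<longrightarrow> 0 \<le> a \<longrightarrow> a \<le> 1 \<longrightarrow> 
    penalty f h G \<rho> (x + a *\<^sub>R u) - penalty f h G \<rho> x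
      \<le> - a * red_penalty f h G \<rho> x u + C * a\<^sup>2 * (norm u)\<^sup>2" if "0 \<le> \<rho>"
proof -
  obtain C where C: "0 \<le> C" and b: "\<And>x e. norm x \<le> R \<Longrightarrow> norm (x + e) \<le> R \<Longrightarrow>
     f (x + e) - f x - grad f x \<bullet> e \<le> C * (norm e)\<^sup>2 \<and>
     viol h G (x + e) - lin_viol h G x e \<le> C * (norm e)\<^sup>2"
    using linearization_errors[of R] by blast
  have "penalty f h G \<rho> (x + a *\<^sub>R u) - penalty f h G \<rho> x
      \<le> - a * red_penalty f h G \<rho> x u + ((\<rho> + 1) * C) * a\<^sup>2 * (norm u)\<^sup>2"
    if x: "norm x \<le> R" "norm (x + a *\<^sub>R u) \<le> R" and a: "0 \<le> a" "a \<le> 1" for x u a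
  proof -
    let ?q = "C * (norm (a *\<^sub>R u))\<^sup>2"
    have "\<rho> * (f (x + a *\<^sub>R u) - f x) \<le> \<rho> * (a * (grad f x \<bullet> u) + ?q)"
      using b[OF x] \<open>0 \<le> \<rho>\<close> by (intro mult_left_mono) auto
    moreover have "viol h G (x + a *\<^sub>R u) \<le> (1 - a) * viol h G x + a * lin_viol h G x u + ?q"
      using b[OF x] lin_viol_convex[OF a, of x u] by linarith
    moreover have "?q = C * a\<^sup>2 * (norm u)\<^sup>2" by (simp add: power_mult_distrib)
    ultimately show ?thesis
      unfolding penalty_def red_penalty_def red_viol_def lin_viol_zero
      by (simp add: algebra_simps)
  qed
  then show ?thesis using C \<open>0 \<le> \<rho>\<close> by (intro exI[of _ "(\<rho> + 1) * C"]) auto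
qed

end

section \<open>Residuals of the feasibility subproblem\<close>

text \<open>The situation of the theorem with the constants of Assumption A made explicit. The compact
set that contains the iterates enters through the radius \<open>R\<close> of a ball around it.\<close>
locale convergent_sqp_run =
  sqp_run f h G \<epsilon> \<delta> \<eta> \<gamma> Bfea B x dfea d r s t \<mu>bar \<mu>hat Ybar Yhat \<rho> \<rho>' \<alpha> +
  smooth_problem f h G
  for f :: "real^'n \<Rightarrow> real"
    and h :: "real^'n \<Rightarrow> real^'l"
    and G :: "real^'n \<Rightarrow> real^'m^'m"
    and \<epsilon> \<delta> \<eta> \<gamma> :: real
    and Bfea B :: "nat \<Rightarrow> real^'n^'n"
    and x dfea d :: "nat \<Rightarrow> real^'n"
    and r s :: "nat \<Rightarrow> real^'l"
    and t :: "nat \<Rightarrow> real"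
    and \<mu>bar \<mu>hat :: "nat \<Rightarrow> real^'l"
    and Ybar Yhat :: "nat \<Rightarrow> real^'m^'m"
    and \<rho> \<rho>' \<alpha> :: "nat \<Rightarrow> real" +
  fixes \<rho>star b1 b2 :: real and R :: real
  assumes rho_lim: "\<rho> \<longlonglongrightarrow> \<rho>star"
    and rho_pos: "\<rho>star > 0"
    and viol_lim: "(\<lambda>k. viol h G (x k)) \<longlonglongrightarrow> 0"
    and x_bounded: "norm (x k) \<le> R"
    and b1: "0 < b1" and b12: "b1 < b2"
    and B_lower: "b1 * (norm u)\<^sup>2 \<le> u \<bullet> (B k *v u)"
    and B_upper: "u \<bullet> (B k *v u) \<le> b2 * (norm u)\<^sup>2"
begin

abbreviation v :: "nat \<Rightarrow> real" where "v k \<equiv> viol h G (x k)"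

text \<open>The zero step, with the positive and negative parts of \<open>h\<^sub>k\<close> and \<open>[\<lambda>\<^sub>1(G\<^sub>k)]\<^sub>+\<close>, is feasible for the
first subproblem and has the objective value \<open>v\<^sub>k\<close>.\<close>
lemma feasibility_residual_le:
  "1 \<bullet> (r k + s k) + t k \<le> v k" "0 \<le> r k" "0 \<le> s k" "0 \<le> t k"
proof -
  let ?c = "(0 :: real^'n, (\<chi> i. max 0 (h (x k) $ i)) :: real^'l,
    (\<chi> i. max 0 (- h (x k) $ i)) :: real^'l, max 0 (lambda_max (G (x k))))"
  have sol: "fea_feasible h G (x k) (dfea k, r k, s k, t k)"
    and opt: "\<And>c. fea_feasible h G (x k) c \<Longrightarrow>
      fea_objective (Bfea k) (dfea k, r k, s k, t k) \<le> fea_objective (Bfea k) c"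
    using fea_solution[of k] by (auto simp: is_arg_min_def not_less)
  from sol show "0 \<le> r k" "0 \<le> s k" and t: "0 \<le> t k" by (simp_all add: fea_feasible_def)
  have "fea_feasible h G (x k) ?c"
    by (auto simp: fea_feasible_def lin_h_def lin_G_def DG_apply_def vec_eq_iff less_eq_vec_def
        loewner_le_mat_iff G_symmetric max_def)
  then have "fea_objective (Bfea k) (dfea k, r k, s k, t k) \<le> fea_objective (Bfea k) ?c"
    by (rule opt)
  also have "fea_objective (Bfea k) ?c = v k"
    by (simp add: fea_objective_def viol_def norm1_def inner_vec_def)
       (intro sum.cong, auto simp: max_def)
  finally have "1 \<bullet> (r k + s k) + t k + (1/2) * (dfea k \<bullet> (Bfea k *v dfea k)) \<le> v k"
    by (simp only: fea_objective_def prod.case)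
  moreover have "0 \<le> dfea k \<bullet> (Bfea k *v dfea k)"
    using pos_def_imp_psd[OF B_pos_def(1)[of k]] by (simp only: psd_def)
  ultimately show "1 \<bullet> (r k + s k) + t k \<le> v k" by linarith
qed

lemma norm1_residual_le: "norm1 (r k - s k) \<le> 1 \<bullet> (r k + s k)"
  unfolding norm1_def inner_vec_def
  using feasibility_residual_le(2,3)[of k]
  by (intro sum_mono) (auto simp: less_eq_vec_def abs_le_iff)

lemma step_feasible: "lin_h h (x k) (d k) = r k - s k" "lin_G G (x k) (d k) \<preceq>\<^sub>L mat (t k)"
  using opt_solution[of k] by (auto simp: is_arg_min_def opt_feasible_def)

text \<open>The second subproblem keeps the residuals \<open>r\<^sub>k\<close>, \<open>s\<^sub>k\<close>, \<open>t\<^sub>k\<close> of the first one, so the linearized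
violation at \<open>d\<^sub>k\<close> is at most \<open>e\<^sup>T (r\<^sub>k + s\<^sub>k) + t\<^sub>k \<le> v\<^sub>k\<close>.\<close>
lemma red_viol_nonneg: "0 \<le> red_viol h G (x k) (d k)"
proof -
  have "lambda_max (lin_G G (x k) (d k)) \<le> t k"
    using step_feasible(2) by (simp add: loewner_le_mat_iff symmetric_lin_G)
  then have "lin_viol h G (x k) (d k) \<le> v k"
    using feasibility_residual_le(1,4)[of k] norm1_residual_le[of k]
    unfolding lin_viol_def step_feasible(1) by linarith
  then show ?thesis by (simp add: red_viol_def lin_viol_zero)
qed

section \<open>Multiplier estimates\<close>
lemma multipliers:
  "\<rho> k *\<^sub>R grad f (x k) + B k *v d k + transpose (jacobian h (at (x k))) *v \<mu>hat (Suc k)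
     + DG_adjoint G (x k) (Yhat (Suc k)) = 0"
  "psd (Yhat (Suc k))" "Yhat (Suc k) \<bullet> (mat (t k) - lin_G G (x k) (d k)) = 0"
  using opt_mult[of k]
  by (simp_all add: opt_multipliers_def inner_diff_right
      trace_inner_eq_inner(1)[OF symmetric_matrix_algebra(2)[OF symmetric_lin_G symmetric_matrix_algebra(1)]])

text \<open>Feasibility and positive semidefiniteness upgrade the scalar complementarity condition to
\<open>Y (t I - G - DG d) = 0\<close>, which is solved for \<open>Y G\<close>.\<close>
lemma complementarity:
  "Yhat (Suc k) ** G (x k) = t k *\<^sub>R Yhat (Suc k) - Yhat (Suc k) ** DG_apply G (x k) (d k)"
proof -
  let ?Y = "Yhat (Suc k)"
  have "?Y ** (mat (t k) - (G (x k) + DG_apply G (x k) (d k))) = 0"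
    using psd_complementary_product_zero[OF multipliers(2) _ multipliers(3)[of k]]
      step_feasible(2)[of k] by (simp add: loewner_le_def lin_G_def)
  moreover have "A ** (M - N) = A ** M - A ** N" for A M N :: "real^'m^'m"
    by (simp add: matrix_matrix_mult_def vec_eq_iff right_diff_distrib sum_subtractf)
  ultimately show ?thesis
    by (simp add: matrix_add_ldistrib matrix_mult_mat algebra_simps)
qed

lemma psd_violation_minus_constraint: "psd (mat (v k) - G (x k))"
proof -
  have "lambda_max (G (x k)) \<le> v k" using norm1_nonneg[of "h (x k)"] by (simp add: viol_def)
  then show ?thesis
    by (simp only: loewner_le_mat_iff[OF G_symmetric, symmetric] loewner_le_def)
qed

text \<open>Stationarity tested with \<open>d\<^sub>k\<close>. The constraints replace \<open>Dh d\<close> by \<open>r - s - h\<close>, and complementarity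
replaces \<open>\<langle>Y, DG d\<rangle>\<close> by \<open>t tr Y - \<langle>Y, G\<rangle>\<close>. Here \<open>\<parallel>r - s - h\<parallel>\<^sub>1 \<le> 2 v\<close> and \<open>\<langle>Y, G\<rangle> \<le> v tr Y\<close>, so
all multiplier terms are of the order of the violation.\<close>
lemma curvature_bound:
  "b1 * (norm (d k))\<^sup>2 \<le> - \<rho> k * (grad f (x k) \<bullet> d k)
     + 2 * (infnorm (\<mu>hat (Suc k)) + trace (Yhat (Suc k))) * v k"
proof -
  let ?Y = "Yhat (Suc k)" and ?\<mu> = "\<mu>hat (Suc k)" and ?d = "d k" and ?D = "DG_apply G (x k) (d k)"
  have "0 = ?d \<bullet> (\<rho> k *\<^sub>R grad f (x k) + B k *v ?d + transpose (jacobian h (at (x k))) *v ?\<mu>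
     + DG_adjoint G (x k) ?Y)"
    by (simp only: multipliers(1) inner_zero_right)
  also have "\<dots> = \<rho> k * (grad f (x k) \<bullet> ?d) + ?d \<bullet> (B k *v ?d)
      + ?\<mu> \<bullet> (jacobian h (at (x k)) *v ?d) + ?Y \<bullet> ?D"
    by (simp add: inner_right_distrib inner_transpose_vector inner_DG_adjoint symmetric_partial_deriv
        del: transpose_matrix_vector) (simp add: inner_commute)
  also have "jacobian h (at (x k)) *v ?d = (r k - s k) + (-1) *\<^sub>R h (x k)"
    using step_feasible(1)[of k] by (simp add: lin_h_def algebra_simps)
  also have "?Y \<bullet> ?D = t k * trace ?Y - ?Y \<bullet> G (x k)"
  proof -
    have "mat (t k) = t k *\<^sub>R (mat 1 :: real^'m^'m)" by (simp add: mat_def vec_eq_iff)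
    then show ?thesis
      using multipliers(3)[of k]
      by (simp add: lin_G_def inner_diff_right inner_right_distrib trace_eq_inner_mat)
  qed
  finally have eq: "- \<rho> k * (grad f (x k) \<bullet> ?d) = ?d \<bullet> (B k *v ?d)
      + ?\<mu> \<bullet> ((r k - s k) + (-1) *\<^sub>R h (x k)) + t k * trace ?Y - ?Y \<bullet> G (x k)" by simp
  have "norm1 ((r k - s k) + (-1) *\<^sub>R h (x k)) \<le> 2 * v k"
  proof -
    have "norm1 (h (x k)) \<le> v k" by (simp add: viol_def)
    moreover have "norm1 (r k - s k) \<le> v k"
      using norm1_residual_le[of k] feasibility_residual_le(1,4)[of k] by linarith
    ultimately show ?thesis
      using norm1_add_le[of "r k - s k" "(-1) *\<^sub>R h (x k)"] unfolding norm1_scaleR by simp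
  qed
  then have "infnorm ?\<mu> * norm1 ((r k - s k) + (-1) *\<^sub>R h (x k)) \<le> infnorm ?\<mu> * (2 * v k)"
    by (intro mult_left_mono infnorm_pos_le)
  with inner_le_infnorm_norm1[of ?\<mu> "(r k - s k) + (-1) *\<^sub>R h (x k)"]
  have mu: "- (2 * infnorm ?\<mu> * v k) \<le> ?\<mu> \<bullet> ((r k - s k) + (-1) *\<^sub>R h (x k))" by linarith
  have trY: "0 \<le> trace ?Y" by (rule psd_trace_nonneg[OF multipliers(2)])
  have "?Y \<bullet> G (x k) \<le> v k * trace ?Y"
  proof -
    from psd_inner_nonneg[OF multipliers(2) psd_violation_minus_constraint, of k k]
    have "?Y \<bullet> G (x k) \<le> ?Y \<bullet> mat (v k)" by (simp add: inner_diff_right)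
    also have "mat (v k) = v k *\<^sub>R (mat 1 :: real^'m^'m)" by (simp add: mat_def vec_eq_iff)
    finally show ?thesis by (simp add: trace_eq_inner_mat)
  qed
  moreover have "0 \<le> t k * trace ?Y" using trY feasibility_residual_le(4)[of k] by simp
  moreover have "0 \<le> v k * trace ?Y" using trY viol_nonneg[of h G "x k"] by simp
  ultimately show ?thesis using eq mu B_lower[of "d k" k]
    by (simp add: algebra_simps)
qed

section \<open>The penalty parameter becomes constant\<close>

text \<open>The third claim reads the update rules backwards: an iteration that does not shrink the parameter
by the factor \<open>\<delta>\<close> leaves it unchanged, and both tests have failed. The first claim needs an argument, as the
quotient \<open>\<zeta>\<^sub>k\<close> could have a negative denominator; but it is only used when
\<open>\<rho>'\<^sub>k g\<^sub>k\<^sup>T d\<^sub>k > (1 - \<epsilon>) \<Delta>l\<^sup>v\<^sub>k(d\<^sub>k) \<ge> 0\<close>, and then the denominator is positive.\<close>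
lemma penalty_parameter_update:
  assumes "0 \<le> \<rho> k"
  shows "0 \<le> \<rho> (Suc k)"
    and "\<rho> (Suc k) \<le> \<rho> k"
    and "\<rho> (Suc k) > \<delta> * \<rho> k \<Longrightarrow> \<rho> (Suc k) = \<rho> k
      \<and> \<rho> k * (infnorm (\<mu>hat (Suc k)) + trace (Yhat (Suc k))) \<le> 1
      \<and> \<epsilon> * red_viol h G (x k) (d k) \<le> red_penalty f h G (\<rho> k) (x k) (d k)"
proof -
  have \<delta>: "0 < \<delta>" "\<delta> < 1" and \<epsilon>: "0 < \<epsilon>" "\<epsilon> < 1" using constants by auto
  have Ybar: "psd (Ybar (Suc k))" using fea_mult[of k] by (auto simp: fea_multipliers_def)
  have \<delta>le: "\<delta> * a \<le> a" if "0 \<le> a" for a using \<delta> that by (simp add: mult_left_le_one_le)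
  have m: "0 \<le> infnorm (\<mu>bar (Suc k)) + trace (Ybar (Suc k))"
    "0 \<le> infnorm (\<mu>hat (Suc k)) + trace (Yhat (Suc k))"
    by (simp_all add: infnorm_pos_le psd_trace_nonneg Ybar multipliers(2) add_nonneg_nonneg)
  have q: "0 \<le> (1 - \<epsilon>) / (infnorm (\<mu>bar (Suc k)) + trace (Ybar (Suc k))
                              + infnorm (\<mu>hat (Suc k)) + trace (Yhat (Suc k)))"
    using m \<epsilon> by (intro divide_nonneg_nonneg) auto
  have \<rho>': "0 \<le> \<rho>' k" "\<rho>' k \<le> \<rho> k"
    unfolding atomize_conj rho'_update[of k]
    using assms \<delta> q \<delta>le[OF assms] by (auto simp: min_le_iff_disj)
  let ?\<zeta> = "(1 - \<epsilon>) * red_viol h G (x k) (d k)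
                    / (grad f (x k) \<bullet> d k + (1/2) * (d k \<bullet> (B k *v d k)))"
  have \<zeta>: "0 \<le> ?\<zeta>" if less: "red_penalty f h G (\<rho>' k) (x k) (d k) < \<epsilon> * red_viol h G (x k) (d k)"
  proof -
    have "0 \<le> (1 - \<epsilon>) * red_viol h G (x k) (d k)" using \<epsilon> red_viol_nonneg[of k] by simp
    moreover have "(1 - \<epsilon>) * red_viol h G (x k) (d k) < \<rho>' k * (grad f (x k) \<bullet> d k)"
      using less by (simp add: red_penalty_def algebra_simps)
    ultimately have "0 < \<rho>' k * (grad f (x k) \<bullet> d k)" by linarith
    then have "0 < grad f (x k) \<bullet> d k" using \<rho>'(1) by (simp add: zero_less_mult_iff)
    moreover have "0 \<le> d k \<bullet> (B k *v d k)"
      using pos_def_imp_psd[OF B_pos_def(2)[of k]] by (simp add: psd_def)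
    ultimately show ?thesis
      using \<open>0 \<le> (1 - \<epsilon>) * red_viol h G (x k) (d k)\<close> by (intro divide_nonneg_nonneg) auto
  qed
  have \<rho>S: "0 \<le> \<rho> (Suc k)" "\<rho> (Suc k) \<le> \<rho>' k"
    unfolding atomize_conj rho_update[of k]
    using \<rho>'(1) \<delta> \<zeta> \<delta>le[OF \<rho>'(1)] by (auto simp: min_le_iff_disj)
  then show "0 \<le> \<rho> (Suc k)" "\<rho> (Suc k) \<le> \<rho> k" using \<rho>'(2) by auto
  assume gt: "\<rho> (Suc k) > \<delta> * \<rho> k"
  let ?c = "\<rho> k * (infnorm (\<mu>bar (Suc k)) + trace (Ybar (Suc k))) > 1 \<or>
             \<rho> k * (infnorm (\<mu>hat (Suc k)) + trace (Yhat (Suc k))) > 1"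
  have nc: "\<not> ?c"
  proof
    assume ?c
    then have "\<rho>' k \<le> \<delta> * \<rho> k" unfolding rho'_update[of k] by auto
    with gt \<rho>S(2) show False by linarith
  qed
  then have eq': "\<rho>' k = \<rho> k" unfolding rho'_update[of k] by auto
  have nl: "\<not> red_penalty f h G (\<rho>' k) (x k) (d k) < \<epsilon> * red_viol h G (x k) (d k)"
  proof
    assume "red_penalty f h G (\<rho>' k) (x k) (d k) < \<epsilon> * red_viol h G (x k) (d k)"
    then have "\<rho> (Suc k) \<le> \<delta> * \<rho>' k" unfolding rho_update[of k] by auto
    with gt eq' show False by simp
  qed
  then have "\<rho> (Suc k) = \<rho> k" unfolding rho_update[of k] using eq' by auto
  with nc nl eq' show "\<rho> (Suc k) = \<rho> k
      \<and> \<rho> k * (infnorm (\<mu>hat (Suc k)) + trace (Yhat (Suc k))) \<le> 1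
      \<and> \<epsilon> * red_viol h G (x k) (d k) \<le> red_penalty f h G (\<rho> k) (x k) (d k)"
    by auto
qed

lemma rho_ge_limit: "\<rho>star \<le> \<rho> k"
proof -
  have nn: "0 \<le> \<rho> k" for k
    by (induction k) (use rho0 penalty_parameter_update(1) in auto)
  then have "decseq \<rho>" by (intro decseq_SucI penalty_parameter_update(2))
  then show ?thesis using rho_lim by (rule decseq_ge)
qed

text \<open>Once \<open>\<rho>\<^sub>k < \<rho>\<^sup>* / \<delta>\<close>, one more reduction would push the parameter below its limit, which is a
lower bound of the decreasing sequence.\<close>
lemma rho_eventually_limit:
  "\<forall>\<^sub>F k in sequentially. \<rho> k = \<rho>star \<and> \<rho> (Suc k) = \<rho>star
      \<and> infnorm (\<mu>hat (Suc k)) + trace (Yhat (Suc k)) \<le> 1 / \<rho>star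
      \<and> \<epsilon> * red_viol h G (x k) (d k) \<le> red_penalty f h G \<rho>star (x k) (d k)"
proof -
  have nn: "0 \<le> \<rho> k" for k using rho_ge_limit[of k] rho_pos by linarith
  have \<delta>: "0 < \<delta>" "\<delta> < 1" using constants by auto
  then have "\<rho>star < \<rho>star / \<delta>" using rho_pos by (simp add: field_simps)
  with rho_lim have "\<forall>\<^sub>F k in sequentially. \<rho> k < \<rho>star / \<delta>" by (rule order_tendstoD(2))
  then obtain K where K: "\<And>k. k \<ge> K \<Longrightarrow> \<rho> k < \<rho>star / \<delta>"
    by (auto simp: eventually_sequentially)
  have gt: "\<delta> * \<rho> k < \<rho> (Suc k)" if "k \<ge> K" for k
    using K[OF that] \<delta> rho_ge_limit[of "Suc k"] by (simp add: field_simps)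
  note c = penalty_parameter_update(3)[OF nn gt]
  have const: "\<rho> k = \<rho> K" if "k \<ge> K" for k
    using that by (induction k rule: dec_induct) (use c in auto)
  have "(\<lambda>k. \<rho> (k + K)) = (\<lambda>_. \<rho> K)" by (rule ext, rule const) simp
  with LIMSEQ_ignore_initial_segment[OF rho_lim, of K] have star: "\<rho> K = \<rho>star"
    by (simp only: LIMSEQ_const_iff)
  show ?thesis
    unfolding eventually_sequentially
  proof (intro exI[of _ K] allI impI)
    fix k assume k: "k \<ge> K"
    have "\<rho> k = \<rho>star" using const[OF k] star by (rule trans)
    with c[OF k] rho_pos show "\<rho> k = \<rho>star \<and> \<rho> (Suc k) = \<rho>star
      \<and> infnorm (\<mu>hat (Suc k)) + trace (Yhat (Suc k)) \<le> 1 / \<rho>star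
      \<and> \<epsilon> * red_viol h G (x k) (d k) \<le> red_penalty f h G \<rho>star (x k) (d k)"
      by (auto simp: field_simps)
  qed
qed

section \<open>Step lengths and vanishing steps\<close>
lemma bounded_along_iterates:
  fixes \<phi> :: "real^'n \<Rightarrow> 'b::real_normed_vector"
  assumes "\<And>z. isCont \<phi> z"
  obtains M where "0 \<le> M" "\<forall>k. norm (\<phi> (x k)) \<le> M"
proof -
  have "compact (\<phi> ` cball 0 R)"
    by (intro compact_continuous_image continuous_at_imp_continuous_on ballI assms) simp
  then have "bounded (\<phi> ` cball 0 R)" by (rule compact_imp_bounded)
  then obtain M where "0 < M" "\<forall>y\<in>\<phi> ` cball 0 R. norm y \<le> M"
    unfolding bounded_pos by (elim exE conjE)
  then show ?thesis using x_bounded by (intro that[of M]) auto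
qed

text \<open>The curvature bound with the constants that the final penalty parameter provides. The third
conjunct bounds the steps, the second one makes them vanish with the predicted
decrease.\<close>
lemma eventual_descent_bounds:
  "\<forall>\<^sub>F k in sequentially. 0 \<le> red_penalty f h G \<rho>star (x k) (d k)
     \<and> b1 * (norm (d k))\<^sup>2 \<le> red_penalty f h G \<rho>star (x k) (d k) + 2 / \<rho>star * v k
     \<and> b1 * (norm (d k))\<^sup>2 \<le> - \<rho>star * (grad f (x k) \<bullet> d k) + 2 / \<rho>star * v k"
  using rho_eventually_limit
proof (rule eventually_mono)
  fix k
  assume *: "\<rho> k = \<rho>star \<and> \<rho> (Suc k) = \<rho>star
      \<and> infnorm (\<mu>hat (Suc k)) + trace (Yhat (Suc k)) \<le> 1 / \<rho>star
      \<and> \<epsilon> * red_viol h G (x k) (d k) \<le> red_penalty f h G \<rho>star (x k) (d k)"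
  have "0 \<le> \<epsilon> * red_viol h G (x k) (d k)"
    using red_viol_nonneg[of k] constants by simp
  moreover have "2 * (infnorm (\<mu>hat (Suc k)) + trace (Yhat (Suc k))) * v k \<le> 2 * (1 / \<rho>star) * v k"
    using * viol_nonneg[of h G "x k"] by (intro mult_right_mono mult_left_mono) auto
  ultimately show "0 \<le> red_penalty f h G \<rho>star (x k) (d k)
     \<and> b1 * (norm (d k))\<^sup>2 \<le> red_penalty f h G \<rho>star (x k) (d k) + 2 / \<rho>star * v k
     \<and> b1 * (norm (d k))\<^sup>2 \<le> - \<rho>star * (grad f (x k) \<bullet> d k) + 2 / \<rho>star * v k"
    using * curvature_bound[of k] red_viol_nonneg[of k]
    unfolding red_penalty_def by (simp only: *) linarith
qed

text \<open>A quadratic in \<open>\<parallel>d\<^sub>k\<parallel>\<close> is at most an affine function of it. The bound is needed before anything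
about the line search can be said, since it confines the trial points to a fixed ball.\<close>
lemma steps_bounded:
  obtains D where "0 < D" "\<forall>\<^sub>F k in sequentially. norm (d k) \<le> D"
proof -
  obtain L where L: "0 \<le> L" "\<forall>k. norm (grad f (x k)) \<le> L"
    by (rule bounded_along_iterates[OF isCont_problem_data(4)])
  let ?N = "\<rho>star * L + 2 / \<rho>star"
  have N: "0 \<le> ?N" using L rho_pos by simp
  have "\<forall>\<^sub>F k in sequentially. v k < 1" using viol_lim by (rule order_tendstoD(2)) simp
  with eventual_descent_bounds have "\<forall>\<^sub>F k in sequentially. norm (d k) \<le> 1 + ?N / b1"
  proof eventually_elim
    fix k
    assume *: "0 \<le> red_penalty f h G \<rho>star (x k) (d k)
     \<and> b1 * (norm (d k))\<^sup>2 \<le> red_penalty f h G \<rho>star (x k) (d k) + 2 / \<rho>star * v k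
     \<and> b1 * (norm (d k))\<^sup>2 \<le> - \<rho>star * (grad f (x k) \<bullet> d k) + 2 / \<rho>star * v k" and v: "v k < 1"
    show "norm (d k) \<le> 1 + ?N / b1"
    \<comment> \<open>for \<open>\<parallel>d\<^sub>k\<parallel> > 1\<close> the constant term is at most the same multiple of \<open>\<parallel>d\<^sub>k\<parallel>\<close>, so one power cancels\<close>
    proof (cases "norm (d k) \<le> 1")
      case True
      moreover have "0 \<le> ?N / b1" using N b1 by simp
      ultimately show ?thesis by linarith
    next
      case False
      have "\<bar>grad f (x k) \<bullet> d k\<bar> \<le> norm (grad f (x k)) * norm (d k)" by (rule Cauchy_Schwarz_ineq2)
      also have "\<dots> \<le> L * norm (d k)" using L by (intro mult_right_mono) auto
      finally have "\<rho>star * \<bar>grad f (x k) \<bullet> d k\<bar> \<le> \<rho>star * (L * norm (d k))"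
        using rho_pos by simp
      moreover have "- \<rho>star * (grad f (x k) \<bullet> d k) \<le> \<rho>star * \<bar>grad f (x k) \<bullet> d k\<bar>"
        using mult_left_mono[of "- (grad f (x k) \<bullet> d k)" "\<bar>grad f (x k) \<bullet> d k\<bar>" \<rho>star] rho_pos by simp
      moreover have "2 / \<rho>star * v k \<le> 2 / \<rho>star * norm (d k)"
        using False v rho_pos by (intro mult_left_mono) auto
      ultimately have "b1 * (norm (d k))\<^sup>2 \<le> ?N * norm (d k)" using * by (simp add: algebra_simps)
      then have "norm (d k) * (b1 * norm (d k)) \<le> norm (d k) * ?N"
        by (simp only: power2_eq_square ac_simps)
      then have "b1 * norm (d k) \<le> ?N"
        by (rule mult_left_le_imp_le) (use False in linarith)
      then have "norm (d k) \<le> ?N / b1" using b1 by (simp add: field_simps)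
      then show ?thesis by simp
    qed
  qed
  moreover have "0 < 1 + ?N / b1" using N b1 by (simp add: add_pos_nonneg)
  ultimately show ?thesis by (intro that)
qed

lemma step_length_bounds:
  "0 < \<alpha> k" "armijo f h G \<eta> (\<rho> (Suc k)) (x k) (d k) (\<alpha> k)"
  "\<alpha> k = 1 \<or> (\<alpha> k / \<gamma> \<le> 1 \<and> \<not> armijo f h G \<eta> (\<rho> (Suc k)) (x k) (d k) (\<alpha> k / \<gamma>))"
proof -
  have \<gamma>: "0 < \<gamma>" "\<gamma> < 1" using constants by auto
  obtain j where j: "\<alpha> k = \<gamma> ^ j" "armijo f h G \<eta> (\<rho> (Suc k)) (x k) (d k) (\<gamma> ^ j)"
    "\<forall>i<j. \<not> armijo f h G \<eta> (\<rho> (Suc k)) (x k) (d k) (\<gamma> ^ i)"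
    using line_search by blast
  show "0 < \<alpha> k" "armijo f h G \<eta> (\<rho> (Suc k)) (x k) (d k) (\<alpha> k)" using j \<gamma> by simp_all
  show "\<alpha> k = 1 \<or> (\<alpha> k / \<gamma> \<le> 1 \<and> \<not> armijo f h G \<eta> (\<rho> (Suc k)) (x k) (d k) (\<alpha> k / \<gamma>))"
  proof (cases j)
    case (Suc i)
    then have "\<alpha> k / \<gamma> = \<gamma> ^ i" using j(1) \<gamma> by simp
    moreover have "\<gamma> ^ i \<le> 1" using \<gamma> by (simp add: power_le_one)
    ultimately show ?thesis using j(3) Suc by simp
  qed (use j in simp)
qed

text \<open>Telescoping: the values of the penalty function decrease and are bounded below, hence converge,
and \<open>\<eta> \<alpha>\<^sub>k \<Delta>\<^sub>k\<close> is at most the difference of two consecutive ones.\<close>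
lemma scaled_descent_tendsto_zero:
  "(\<lambda>k. \<alpha> k * red_penalty f h G \<rho>star (x k) (d k)) \<longlonglongrightarrow> 0"
proof -
  let ?P = "\<lambda>k. penalty f h G \<rho>star (x k)" and ?\<Delta> = "\<lambda>k. red_penalty f h G \<rho>star (x k) (d k)"
  have \<eta>: "0 < \<eta>" using constants by auto
  obtain K where K: "\<And>k. k \<ge> K \<Longrightarrow> 0 \<le> ?\<Delta> k \<and> \<rho> (Suc k) = \<rho>star"
    using eventually_conj[OF eventual_descent_bounds rho_eventually_limit]
    by (auto simp: eventually_sequentially)
  have dec: "\<eta> * (\<alpha> k * ?\<Delta> k) \<le> ?P k - ?P (Suc k)" if "k \<ge> K" for k
    using step_length_bounds(2)[of k] K[OF that] by (simp add: armijo_def step)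
  have nn: "0 \<le> \<alpha> k * ?\<Delta> k" if "k \<ge> K" for k
    using K[OF that] step_length_bounds(1)[of k] by simp
  obtain M where M: "0 \<le> M" "\<forall>k. norm (f (x k)) \<le> M"
    by (rule bounded_along_iterates[OF isCont_problem_data(1)])
  have lower: "- (\<rho>star * M) \<le> ?P k" for k
  proof -
    have "\<rho>star * (- M) \<le> \<rho>star * f (x k)"
      using M(2)[rule_format, of k] rho_pos by (intro mult_left_mono) auto
    then show ?thesis using viol_nonneg[of h G "x k"] by (simp add: penalty_def)
  qed
  have "decseq (\<lambda>k. ?P (k + K))"
  proof (rule decseq_SucI)
    fix k
    have "0 \<le> \<eta> * (\<alpha> (k + K) * ?\<Delta> (k + K))" using nn[of "k + K"] \<eta> by simp
    then show "?P (Suc k + K) \<le> ?P (k + K)" using dec[of "k + K"] by simp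
  qed
  then obtain l where "(\<lambda>k. ?P (k + K)) \<longlonglongrightarrow> l"
    by (rule decseq_convergent) (use lower in blast)
  then have l: "?P \<longlonglongrightarrow> l" by (rule LIMSEQ_offset)
  have "(\<lambda>k. (?P k - ?P (Suc k)) / \<eta>) \<longlonglongrightarrow> (l - l) / \<eta>"
    by (intro tendsto_divide tendsto_diff tendsto_const l LIMSEQ_Suc[OF l]) (use \<eta> in simp)
  then have lim: "(\<lambda>k. (?P k - ?P (Suc k)) / \<eta>) \<longlonglongrightarrow> 0" by simp
  show ?thesis
  proof (rule tendsto_sandwich[OF _ _ tendsto_const lim])
    show "\<forall>\<^sub>F k in sequentially. 0 \<le> \<alpha> k * ?\<Delta> k"
      unfolding eventually_sequentially using nn by blast
    show "\<forall>\<^sub>F k in sequentially. \<alpha> k * ?\<Delta> k \<le> (?P k - ?P (Suc k)) / \<eta>"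
      unfolding eventually_sequentially using dec \<eta> by (auto simp: field_simps)
  qed
qed

text \<open>If \<open>\<alpha>\<^sub>k < 1\<close>, the previous trial \<open>a = \<alpha>\<^sub>k / \<gamma>\<close> was rejected. Comparing the failed Armijo condition
with the quadratic bound gives \<open>(1 - \<eta>) \<Delta>\<^sub>k < C a \<parallel>d\<^sub>k\<parallel>\<^sup>2\<close>.\<close>
lemma step_length_lower_bound:
  obtains c where "0 < c" "\<forall>\<^sub>F k in sequentially.
    min 1 (c * red_penalty f h G \<rho>star (x k) (d k)) \<le> \<alpha> k"
proof -
  let ?\<Delta> = "\<lambda>k. red_penalty f h G \<rho>star (x k) (d k)"
  have \<gamma>: "0 < \<gamma>" "\<gamma> < 1" and \<eta>: "0 < \<eta>" "\<eta> < 1" using constants by auto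
  obtain D where D: "0 < D" "\<forall>\<^sub>F k in sequentially. norm (d k) \<le> D" by (rule steps_bounded)
  obtain C where C: "0 \<le> C" and decrease: "\<And>z u a. norm z \<le> R + D \<Longrightarrow> norm (z + a *\<^sub>R u) \<le> R + D \<Longrightarrow>
    0 \<le> a \<Longrightarrow> a \<le> 1 \<Longrightarrow> 
    penalty f h G \<rho>star (z + a *\<^sub>R u) - penalty f h G \<rho>star z
      \<le> - a * red_penalty f h G \<rho>star z u + C * a\<^sup>2 * (norm u)\<^sup>2"
    using penalty_decrease[of \<rho>star "R + D"] rho_pos by auto
  \<comment> \<open>the summand \<open>1\<close> keeps the denominator of \<open>c\<close> positive\<close>
  let ?C = "C * D\<^sup>2 + 1"
  have C': "0 < ?C" using C by (simp add: add_nonneg_pos)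
  define c where "c = \<gamma> * (1 - \<eta>) / ?C"
  have c: "0 < c" using \<gamma> \<eta> C' by (simp add: c_def)
  have "\<forall>\<^sub>F k in sequentially. min 1 (c * ?\<Delta> k) \<le> \<alpha> k"
    using D(2) rho_eventually_limit
  proof eventually_elim
    fix k
    assume d: "norm (d k) \<le> D" and *: "\<rho> k = \<rho>star \<and> \<rho> (Suc k) = \<rho>star
      \<and> infnorm (\<mu>hat (Suc k)) + trace (Yhat (Suc k)) \<le> 1 / \<rho>star
      \<and> \<epsilon> * red_viol h G (x k) (d k) \<le> red_penalty f h G \<rho>star (x k) (d k)"
    show "min 1 (c * ?\<Delta> k) \<le> \<alpha> k"
    proof (cases "\<alpha> k = 1")
      case False
      define a where "a = \<alpha> k / \<gamma>"
      have a: "0 < a" "a \<le> 1" and fails: "\<not> armijo f h G \<eta> \<rho>star (x k) (d k) a"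
        using False step_length_bounds[of k] \<gamma> * by (auto simp: a_def)
      have "norm (x k + a *\<^sub>R d k) \<le> norm (x k) + a * norm (d k)"
        using norm_triangle_ineq[of "x k" "a *\<^sub>R d k"] a by simp
      also have "a * norm (d k) \<le> 1 * D" using a d by (intro mult_mono) auto
      finally have "norm (x k + a *\<^sub>R d k) \<le> R + D" using x_bounded[of k] by simp
      moreover have "norm (x k) \<le> R + D" using x_bounded[of k] D(1) by linarith
      ultimately have "penalty f h G \<rho>star (x k + a *\<^sub>R d k) - penalty f h G \<rho>star (x k)
         \<le> - a * ?\<Delta> k + C * a\<^sup>2 * (norm (d k))\<^sup>2"
        using a by (intro decrease) auto
      with fails have "- \<eta> * a * ?\<Delta> k < - a * ?\<Delta> k + C * a\<^sup>2 * (norm (d k))\<^sup>2"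
        by (simp add: armijo_def)
      then have "a * ((1 - \<eta>) * ?\<Delta> k) < a * (C * a * (norm (d k))\<^sup>2)"
        by (simp add: algebra_simps power2_eq_square)
      then have "(1 - \<eta>) * ?\<Delta> k < (C * (norm (d k))\<^sup>2) * a" using a by (simp add: ac_simps)
      also have "\<dots> \<le> ?C * a"
      proof -
        have "C * (norm (d k))\<^sup>2 \<le> C * D\<^sup>2" using C d by (intro mult_left_mono power_mono) auto
        then show ?thesis using a by (intro mult_right_mono) auto
      qed
      finally have "\<gamma> * ((1 - \<eta>) * ?\<Delta> k) \<le> \<gamma> * (?C * a)" using \<gamma> by simp
      then have "\<gamma> * (1 - \<eta>) * ?\<Delta> k \<le> ?C * \<alpha> k" using \<gamma> by (simp add: a_def ac_simps)
      then have "c * ?\<Delta> k \<le> \<alpha> k" using C' by (simp add: c_def field_simps)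
      then show ?thesis by simp
    qed simp
  qed
  with c show ?thesis by (rule that)
qed

text \<open>If \<open>\<Delta>\<^sub>k \<ge> e\<close>, then \<open>\<alpha>\<^sub>k \<Delta>\<^sub>k \<ge> min 1 (c e) e\<close>, which happens only finitely often.\<close>
lemma descent_tendsto_zero: "(\<lambda>k. red_penalty f h G \<rho>star (x k) (d k)) \<longlonglongrightarrow> 0"
proof -
  let ?\<Delta> = "\<lambda>k. red_penalty f h G \<rho>star (x k) (d k)"
  obtain c where c: "0 < c" "\<forall>\<^sub>F k in sequentially. min 1 (c * ?\<Delta> k) \<le> \<alpha> k"
    by (rule step_length_lower_bound)
  show ?thesis
  proof (rule tendstoI)
    fix e :: real assume e: "0 < e"
    have "0 < min 1 (c * e) * e" using c e by simp
    with scaled_descent_tendsto_zero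
    have "\<forall>\<^sub>F k in sequentially. \<alpha> k * ?\<Delta> k < min 1 (c * e) * e" by (rule order_tendstoD(2))
    with c(2) eventual_descent_bounds show "\<forall>\<^sub>F k in sequentially. dist (?\<Delta> k) 0 < e"
    proof eventually_elim
      fix k
      assume 1: "min 1 (c * ?\<Delta> k) \<le> \<alpha> k" and 2: "0 \<le> ?\<Delta> k
     \<and> b1 * (norm (d k))\<^sup>2 \<le> ?\<Delta> k + 2 / \<rho>star * v k
     \<and> b1 * (norm (d k))\<^sup>2 \<le> - \<rho>star * (grad f (x k) \<bullet> d k) + 2 / \<rho>star * v k"
        and 3: "\<alpha> k * ?\<Delta> k < min 1 (c * e) * e"
      have "?\<Delta> k < e"
      proof (rule ccontr)
        assume "\<not> ?\<Delta> k < e"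
        then have le: "e \<le> ?\<Delta> k" by simp
        then have "min 1 (c * e) \<le> min 1 (c * ?\<Delta> k)"
          using c(1) by (intro min.mono mult_left_mono) auto
        with 1 have "min 1 (c * e) \<le> \<alpha> k" by linarith
        then have "min 1 (c * e) * e \<le> \<alpha> k * ?\<Delta> k"
          using le e step_length_bounds(1)[of k] by (intro mult_mono) auto
        with 3 show False by linarith
      qed
      with 2 show "dist (?\<Delta> k) 0 < e" by simp
    qed
  qed
qed

lemma steps_tendsto_zero: "d \<longlonglongrightarrow> 0"
proof -
  have "(\<lambda>k. (red_penalty f h G \<rho>star (x k) (d k) + 2 / \<rho>star * v k) / b1)
      \<longlonglongrightarrow> (0 + 2 / \<rho>star * 0) / b1"
    by (intro tendsto_divide tendsto_add tendsto_mult tendsto_const descent_tendsto_zero viol_lim)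
      (use b1 in simp)
  then have lim: "(\<lambda>k. (red_penalty f h G \<rho>star (x k) (d k) + 2 / \<rho>star * v k) / b1) \<longlonglongrightarrow> 0"
    by simp
  have "(\<lambda>k. (norm (d k))\<^sup>2) \<longlonglongrightarrow> 0"
  proof (rule tendsto_sandwich[OF _ _ tendsto_const lim])
    show "\<forall>\<^sub>F k in sequentially. (norm (d k))\<^sup>2
        \<le> (red_penalty f h G \<rho>star (x k) (d k) + 2 / \<rho>star * v k) / b1"
      using eventual_descent_bounds by (rule eventually_mono) (use b1 in \<open>simp add: field_simps\<close>)
  qed simp
  then have "(\<lambda>k. sqrt ((norm (d k))\<^sup>2)) \<longlonglongrightarrow> sqrt 0" by (rule tendsto_real_sqrt)
  then show ?thesis by (simp add: tendsto_norm_zero_iff)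
qed

lemma t_tendsto_zero: "t \<longlonglongrightarrow> 0"
proof (rule tendsto_sandwich[OF _ _ tendsto_const viol_lim])
  have "t k \<le> v k" for k
    using feasibility_residual_le(1)[of k] norm1_residual_le[of k] norm1_nonneg[of "r k - s k"]
    by linarith
  then show "\<forall>\<^sub>F k in sequentially. t k \<le> v k" by simp
qed (simp add: feasibility_residual_le)

lemma B_step_tendsto_zero: "(\<lambda>k. B k *v d k) \<longlonglongrightarrow> 0"
proof (rule Lim_null_comparison)
  have "norm (B k *v d k) \<le> b2 * norm (d k)" for k
    using b1 b12 B_upper by (intro psd_norm_le pos_def_imp_psd B_pos_def) auto
  then show "\<forall>\<^sub>F k in sequentially. norm (B k *v d k) \<le> b2 * norm (d k)" by simp
  show "(\<lambda>k. b2 * norm (d k)) \<longlonglongrightarrow> 0"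
    using tendsto_mult_right_zero[OF tendsto_norm_zero[OF steps_tendsto_zero]] .
qed

lemma DG_step_tendsto_zero: "(\<lambda>k. DG_apply G (x k) (d k)) \<longlonglongrightarrow> 0"
  unfolding DG_apply_def
proof (rule tendsto_null_sum)
  fix i
  obtain M where M: "0 \<le> M" "\<forall>k. norm (partial_deriv G (x k) i) \<le> M"
    by (rule bounded_along_iterates[OF isCont_problem_data(6)])
  show "(\<lambda>k. d k $ i *\<^sub>R partial_deriv G (x k) i) \<longlonglongrightarrow> 0"
  proof (rule Lim_null_comparison)
    have "norm (d k $ i *\<^sub>R partial_deriv G (x k) i) \<le> norm (d k) * M" for k
      using M by (simp add: mult_mono component_le_norm_cart)
    then show "\<forall>\<^sub>F k in sequentially. norm (d k $ i *\<^sub>R partial_deriv G (x k) i) \<le> norm (d k) * M"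
      by simp
    show "(\<lambda>k. norm (d k) * M) \<longlonglongrightarrow> 0"
      using tendsto_mult_left_zero[OF tendsto_norm_zero[OF steps_tendsto_zero]] .
  qed
qed

lemma YG_tendsto_zero: "(\<lambda>k. Yhat (Suc k) ** G (x k)) \<longlonglongrightarrow> 0"
proof (rule Lim_null_comparison)
  let ?b = "\<lambda>k. (t k + norm (DG_apply G (x k) (d k))) * (1 / \<rho>star)"
  show "\<forall>\<^sub>F k in sequentially. norm (Yhat (Suc k) ** G (x k)) \<le> ?b k"
    using rho_eventually_limit
  proof (rule eventually_mono)
    fix k
    assume *: "\<rho> k = \<rho>star \<and> \<rho> (Suc k) = \<rho>star
      \<and> infnorm (\<mu>hat (Suc k)) + trace (Yhat (Suc k)) \<le> 1 / \<rho>star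
      \<and> \<epsilon> * red_viol h G (x k) (d k) \<le> red_penalty f h G \<rho>star (x k) (d k)"
    let ?Y = "Yhat (Suc k)" and ?D = "DG_apply G (x k) (d k)"
    have Y: "norm ?Y \<le> 1 / \<rho>star"
      using norm_psd_le_trace[OF multipliers(2)[of k]] infnorm_pos_le[of "\<mu>hat (Suc k)"] * by linarith
    have t: "0 \<le> t k" by (rule feasibility_residual_le)
    have "norm (?Y ** G (x k)) \<le> norm (t k *\<^sub>R ?Y) + norm (?Y ** ?D)"
      unfolding complementarity by (rule norm_triangle_ineq4)
    also have "\<dots> \<le> t k * norm ?Y + norm ?Y * norm ?D"
      using t norm_matrix_matrix_le[of ?Y ?D] by simp
    also have "\<dots> = (t k + norm ?D) * norm ?Y" by (simp add: algebra_simps)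
    also have "\<dots> \<le> ?b k" using t Y by (intro mult_left_mono) auto
    finally show "norm (?Y ** G (x k)) \<le> ?b k" .
  qed
  have "?b \<longlonglongrightarrow> (0 + 0) * (1 / \<rho>star)"
    by (intro tendsto_mult tendsto_add tendsto_const t_tendsto_zero
        tendsto_norm_zero[OF DG_step_tendsto_zero])
  then show "?b \<longlonglongrightarrow> 0" by simp
qed

section \<open>Optimality residual and limit points\<close>
lemma lagrangian_gradient:
  "\<rho> k *\<^sub>R grad f (x k) + transpose (jacobian h (at (x k))) *v \<mu>hat (Suc k)
     + DG_adjoint G (x k) (Yhat (Suc k)) = - (B k *v d k)"
  using multipliers(1)[of k] by (simp add: algebra_simps eq_neg_iff_add_eq_0)

lemma optimality_residual_tendsto_zero:
  "(\<lambda>k. R_opt f h G (x k) (\<rho> k) (\<mu>hat (Suc k)) (Yhat (Suc k))) \<longlonglongrightarrow> 0"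
proof -
  have g: "grad (\<lambda>z. fritz_john f h G z (\<rho> k) (\<mu>hat (Suc k)) (Yhat (Suc k))) (x k)
      = - (B k *v d k)" for k
  proof -
    obtain f' h' G' where "(f has_derivative f') (at (x k))" "(h has_derivative h') (at (x k))"
      "(G has_derivative G') (at (x k))" by (rule problem_data_differentiable)
    note grad_fritz_john[OF this G_sym, of "\<rho> k" "\<mu>hat (Suc k)" "Yhat (Suc k)"]
    then show ?thesis by (simp only: lagrangian_gradient)
  qed
  have upper: "R_opt f h G (x k) (\<rho> k) (\<mu>hat (Suc k)) (Yhat (Suc k))
      \<le> norm (B k *v d k) + norm (Yhat (Suc k) ** G (x k))" for k
    unfolding R_opt_def g using infnorm_le_norm[of "- (B k *v d k)"] by simp
  have lower: "0 \<le> R_opt f h G (x k) (\<rho> k) (\<mu>hat (Suc k)) (Yhat (Suc k))" for k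
    by (simp add: R_opt_def infnorm_pos_le)
  have lim: "(\<lambda>k. norm (B k *v d k) + norm (Yhat (Suc k) ** G (x k))) \<longlonglongrightarrow> 0"
    using tendsto_add[OF tendsto_norm_zero[OF B_step_tendsto_zero]
        tendsto_norm_zero[OF YG_tendsto_zero]] by simp
  show ?thesis
    by (rule tendsto_sandwich[OF always_eventually always_eventually tendsto_const lim])
      (use lower upper in blast)+
qed

text \<open>Each KKT condition is the limit of an exact or asymptotic identity along the subsequence:
stationarity up to \<open>- B\<^sub>k d\<^sub>k / \<rho>\<^sub>k\<close>, \<open>\<parallel>h\<^sub>k\<parallel> \<le> v\<^sub>k\<close>, \<open>v\<^sub>k I - G\<^sub>k \<succeq> 0\<close>, and the trace of \<open>Y\<^sub>k G\<^sub>k / \<rho>\<^sub>k\<close>.\<close>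
lemma limit_point_KKT:
  assumes \<sigma>: "strict_mono \<sigma>"
    and x: "(\<lambda>k. x (\<sigma> k)) \<longlonglongrightarrow> xs"
    and \<mu>: "(\<lambda>k. \<mu>hat (Suc (\<sigma> k)) /\<^sub>R \<rho> (\<sigma> k)) \<longlonglongrightarrow> \<mu>s"
    and Y: "(\<lambda>k. Yhat (Suc (\<sigma> k)) /\<^sub>R \<rho> (\<sigma> k)) \<longlonglongrightarrow> Ys"
  shows "KKT_point f h G xs \<mu>s Ys"
proof -
  note sub = LIMSEQ_subseq_LIMSEQ[OF _ \<sigma>, unfolded o_def]
  note cont = isCont_tendsto_compose[OF isCont_problem_data(2) x]
    isCont_tendsto_compose[OF isCont_problem_data(3) x]
    isCont_tendsto_compose[OF isCont_problem_data(4) x]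
    isCont_tendsto_compose[OF isCont_problem_data(5) x]
    isCont_tendsto_compose[OF isCont_problem_data(6) x]
  have \<rho>: "0 < \<rho> k" for k using rho_ge_limit[of k] rho_pos by linarith
  have inv: "(\<lambda>k. inverse (\<rho> (\<sigma> k))) \<longlonglongrightarrow> inverse \<rho>star"
    using sub[OF rho_lim] rho_pos by (intro tendsto_inverse) auto
  have adj: "DG_adjoint G z (c *\<^sub>R Z) = c *\<^sub>R DG_adjoint G z Z" for z c Z
    by (simp add: DG_adjoint_def vec_eq_iff trace_inner_eq_inner[OF symmetric_partial_deriv])
  have "(\<lambda>k. grad f (x (\<sigma> k)) + transpose (jacobian h (at (x (\<sigma> k)))) *v (\<mu>hat (Suc (\<sigma> k)) /\<^sub>R \<rho> (\<sigma> k))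
      + DG_adjoint G (x (\<sigma> k)) (Yhat (Suc (\<sigma> k)) /\<^sub>R \<rho> (\<sigma> k)))
     \<longlonglongrightarrow> grad f xs + transpose (jacobian h (at xs)) *v \<mu>s + DG_adjoint G xs Ys"
    unfolding DG_adjoint_def trace_inner_eq_inner[OF symmetric_partial_deriv]
    by (intro tendsto_add tendsto_matrix_vector_mult tendsto_transpose tendsto_vec_lambda
        tendsto_inner cont \<mu> Y)
  moreover have "grad f (x k) + transpose (jacobian h (at (x k))) *v (\<mu>hat (Suc k) /\<^sub>R \<rho> k)
      + DG_adjoint G (x k) (Yhat (Suc k) /\<^sub>R \<rho> k) = inverse (\<rho> k) *\<^sub>R (- (B k *v d k))" for k
    unfolding lagrangian_gradient[symmetric] adj matrix_vector_mult_scaleR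
    using \<rho>[of k] by (simp add: scaleR_add_right)
  moreover have "(\<lambda>k. inverse (\<rho> (\<sigma> k)) *\<^sub>R (- (B (\<sigma> k) *v d (\<sigma> k)))) \<longlonglongrightarrow> inverse \<rho>star *\<^sub>R (- 0)"
    by (intro tendsto_scaleR tendsto_minus inv sub[OF B_step_tendsto_zero])
  ultimately have stat: "grad f xs + transpose (jacobian h (at xs)) *v \<mu>s + DG_adjoint G xs Ys = 0"
    by (simp add: LIMSEQ_unique)
  have "(\<lambda>k. h (x k)) \<longlonglongrightarrow> 0"
  proof (rule Lim_null_comparison[OF _ viol_lim])
    have "norm (h (x k)) \<le> v k" for k using norm_le_norm1[of "h (x k)"] by (simp add: viol_def)
    then show "\<forall>\<^sub>F k in sequentially. norm (h (x k)) \<le> v k" by simp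
  qed
  from LIMSEQ_unique[OF sub[OF this] cont(1)] have hz: "h xs = 0" by simp
  have Gk: "psd (mat (v k) - G (x k))" for k
    by (rule psd_violation_minus_constraint)
  have Glim: "(\<lambda>k. mat (v (\<sigma> k)) - G (x (\<sigma> k))) \<longlonglongrightarrow> 0 - G xs"
  proof -
    have m: "mat c = c *\<^sub>R (mat 1 :: real^'m^'m)" for c by (simp add: mat_def vec_eq_iff)
    have "(\<lambda>k. v (\<sigma> k) *\<^sub>R mat 1 - G (x (\<sigma> k))) \<longlonglongrightarrow> 0 *\<^sub>R (mat 1 :: real^'m^'m) - G xs"
      by (intro tendsto_diff tendsto_scaleR tendsto_const sub[OF viol_lim] cont)
    then show ?thesis unfolding m[of "v _"] by simp
  qed
  have Gz: "G xs \<preceq>\<^sub>L 0"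
    unfolding loewner_le_def by (rule psd_limit[OF Glim trivial_limit_sequentially Gk])
  have Yk: "psd (Yhat (Suc k) /\<^sub>R \<rho> k)" for k
    using multipliers(2)[of k] \<rho>[of k]
    by (auto simp: psd_def symmetric_matrix_algebra simp flip: scaleR_matrix_vector_assoc)
  have Yz: "psd Ys" by (rule psd_limit[OF Y trivial_limit_sequentially Yk])
  have "(\<lambda>k. inverse (\<rho> (\<sigma> k)) * ((Yhat (Suc (\<sigma> k)) ** G (x (\<sigma> k))) \<bullet> mat 1)) \<longlonglongrightarrow> inverse \<rho>star * (0 \<bullet> (mat 1 :: real^'m^'m))"
    by (intro tendsto_mult tendsto_inner tendsto_const inv sub[OF YG_tendsto_zero])
  moreover have "inverse (\<rho> k) * ((Yhat (Suc k) ** G (x k)) \<bullet> mat 1) = (Yhat (Suc k) /\<^sub>R \<rho> k) \<bullet> G (x k)" for k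
    using trace_inner_eq_inner(1)[OF G_symmetric, of "Yhat (Suc k)" "x k"]
    by (simp add: trace_inner_def trace_eq_inner_mat)
  moreover have "(\<lambda>k. (Yhat (Suc (\<sigma> k)) /\<^sub>R \<rho> (\<sigma> k)) \<bullet> G (x (\<sigma> k))) \<longlonglongrightarrow> Ys \<bullet> G xs"
    by (intro tendsto_inner Y cont)
  ultimately have "Ys \<bullet> G xs = 0" by (simp add: LIMSEQ_unique)
  then show ?thesis
    using stat hz Gz Yz by (simp add: KKT_point_def trace_inner_eq_inner[OF G_symmetric])
qed

end

theorem theorem14:
  fixes f :: "real^'n \<Rightarrow> real"
    and h :: "real^'n \<Rightarrow> real^'l"
    and G :: "real^'n \<Rightarrow> real^'m^'m"
    and \<epsilon> \<delta> \<eta> \<gamma> \<rho>star :: real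
    and Bfea B :: "nat \<Rightarrow> real^'n^'n"
    and x dfea d :: "nat \<Rightarrow> real^'n"
    and r s :: "nat \<Rightarrow> real^'l"
    and t :: "nat \<Rightarrow> real"
    and \<mu>bar \<mu>hat :: "nat \<Rightarrow> real^'l"
    and Ybar Yhat :: "nat \<Rightarrow> real^'m^'m"
    and \<rho> \<rho>' \<alpha> :: "nat \<Rightarrow> real"
  assumes run: "sqp_run f h G \<epsilon> \<delta> \<eta> \<gamma> Bfea B x dfea d r s t \<mu>bar \<mu>hat Ybar Yhat \<rho> \<rho>' \<alpha>"
    and A: "assumption_A f h G Bfea B x"
    and rho_lim: "\<rho> \<longlonglongrightarrow> \<rho>star"
    and rho_pos: "\<rho>star > 0"
    and viol_lim: "(\<lambda>k. viol h G (x k)) \<longlonglongrightarrow> 0"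
  shows "(\<lambda>k. R_opt f h G (x k) (\<rho> k) (\<mu>hat (Suc k)) (Yhat (Suc k))) \<longlonglongrightarrow> 0 \<and>
         (\<forall>xstar \<mu>star Ystar.
            (\<exists>\<sigma>. strict_mono (\<sigma> :: nat \<Rightarrow> nat) \<and>
               ((\<lambda>k. (x k, \<mu>hat (Suc k) /\<^sub>R \<rho> k, Yhat (Suc k) /\<^sub>R \<rho> k)) \<circ> \<sigma>)
                 \<longlonglongrightarrow> (xstar, \<mu>star /\<^sub>R \<rho>star, Ystar /\<^sub>R \<rho>star)) \<longrightarrow>
            KKT_point f h G xstar (\<mu>star /\<^sub>R \<rho>star) (Ystar /\<^sub>R \<rho>star))"
proof -
  interpret sqp_run f h G \<epsilon> \<delta> \<eta> \<gamma> Bfea B x dfea d r s t \<mu>bar \<mu>hat Ybar Yhat \<rho> \<rho>' \<alpha>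
    by (rule run)
  from A obtain \<Omega> b1 b2 where smooth: "twice_continuously_differentiable f"
     "twice_continuously_differentiable h" "twice_continuously_differentiable G"
    and \<Omega>: "compact \<Omega>" "\<forall>k. x k \<in> \<Omega>"
    and b: "0 < b1" "b1 < b2" "\<forall>k d. b1 * (norm d)\<^sup>2 \<le> d \<bullet> (B k *v d) \<and> d \<bullet> (B k *v d) \<le> b2 * (norm d)\<^sup>2"
    unfolding assumption_A_def by blast
  obtain R where R: "\<forall>z\<in>\<Omega>. norm z \<le> R"
    using compact_imp_bounded[OF \<Omega>(1)] unfolding bounded_iff by blast
  interpret convergent_sqp_run f h G \<epsilon> \<delta> \<eta> \<gamma> Bfea B x dfea d r s t \<mu>bar \<mu>hat Ybar Yhat \<rho> \<rho>' \<alpha>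
      \<rho>star b1 b2 R
    by unfold_locales (use smooth G_symmetric rho_lim rho_pos viol_lim R \<Omega>(2) b in auto)
  have "KKT_point f h G xstar (\<mu>star /\<^sub>R \<rho>star) (Ystar /\<^sub>R \<rho>star)"
    if \<sigma>: "strict_mono \<sigma>" and lim: "((\<lambda>k. (x k, \<mu>hat (Suc k) /\<^sub>R \<rho> k, Yhat (Suc k) /\<^sub>R \<rho> k)) \<circ> \<sigma>)
                 \<longlonglongrightarrow> (xstar, \<mu>star /\<^sub>R \<rho>star, Ystar /\<^sub>R \<rho>star)"
    for xstar \<mu>star Ystar and \<sigma> :: "nat \<Rightarrow> nat"
    using tendsto_fst[OF lim] tendsto_fst[OF tendsto_snd[OF lim]] tendsto_snd[OF tendsto_snd[OF lim]]
    by (intro limit_point_KKT[OF \<sigma>]) (simp_all add: o_def)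
  with optimality_residual_tendsto_zero show ?thesis by blast
qed

end
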